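(* Let $h:[0,1)\to\mathbb{R}$ and $\sigma:[0,1)\to(0,\infty)$ be continuous functions, and let $B$ be a standard Brownian motion. For $x,y\in\mathbb{R}$ let $(X^{xy}_t)_{t\in[0,1)}$ be the unique strong solution of the stochastic differential equation $$dX_t = h(t)(y-X_t)\,dt+\sigma(t)\,dB_t,\quad t\in[0,1),\qquad X_0=x.$$ Assume that (A1) $h$ is bounded from below on $[0,1)$ and $\lim_{t\to1}\int_0^t h(r)\,dr=+\infty$; (A2) $\lim_{t\to 1}\int_0^t\sigma^2(r)\,dr<+\infty$. Then $\{X^{xy},\,x,y\in\mathbb{R}\}$ is a family of pinned diffusions, i.e. for all $x,y\in\mathbb{R}$, $$\mathbf{P}\Big(\lim_{t\to1}X^{xy}_t=y\Big)=1.$$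
   Context: All processes live on a filtered probability space $(\Omega,\mathscr{F},(\mathscr{F}_t)_{t\in[0,1]},\mathbf{P})$ satisfying the usual conditions, and $B$ is a standard Brownian motion with respect to $(\mathscr{F}_t)$. The solution of the equation is explicitly $$X^{xy}_t=\phi(t)x+(1-\phi(t))y+\phi(t)\int_0^t\frac{\sigma(r)}{\phi(r)}\,dB_r,\quad t\in[0,1),\qquad \phi(t):=\exp\Big(-\int_0^t h(r)\,dr\Big).$$ *)

theory Defs
  imports "HOL-Probability.Probability"
begin

text \<open>
  Filtrations are indexed by the time interval \<open>[0, 1]\<close>; \<open>F t\<close> is irrelevant for \<open>t\<close> outside it.
  Completeness of \<open>M\<close> and the last two assumptions are the usual conditions.
\<close>

locale usual_filtered_prob_space = prob_space M + complete_measure M for M :: "'a measure" +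
  fixes F :: "real \<Rightarrow> 'a measure"
  assumes subalgebra_F: "t \<in> {0..1} \<Longrightarrow> subalgebra M (F t)"
    and F_mono: "0 \<le> s \<Longrightarrow> s \<le> t \<Longrightarrow> t \<le> 1 \<Longrightarrow> sets (F s) \<subseteq> sets (F t)"
    and null_sets_F: "null_sets M \<subseteq> sets (F 0)"
    and right_continuous_F: "0 \<le> t \<Longrightarrow> t < 1 \<Longrightarrow> sets (F t) = (\<Inter>u\<in>{t<..1}. sets (F u))"

locale brownian_motion = usual_filtered_prob_space M F
  for M :: "'a measure" and F :: "real \<Rightarrow> 'a measure" +
  fixes B :: "real \<Rightarrow> 'a \<Rightarrow> real"
  assumes adapted_B: "t \<in> {0..1} \<Longrightarrow> B t \<in> borel_measurable (F t)"
    and B_0: "AE \<omega> in M. B 0 \<omega> = 0"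
    and continuous_B: "AE \<omega> in M. continuous_on {0..1} (\<lambda>t. B t \<omega>)"
    and normal_increments: "0 \<le> s \<Longrightarrow> s < t \<Longrightarrow> t \<le> 1 \<Longrightarrow>
      distributed M lborel (\<lambda>\<omega>. B t \<omega> - B s \<omega>) (normal_density 0 (sqrt (t - s)))"
    and independent_increments: "0 \<le> s \<Longrightarrow> s < t \<Longrightarrow> t \<le> 1 \<Longrightarrow>
      indep_set (sets (F s)) {(\<lambda>\<omega>. B t \<omega> - B s \<omega>) -` S \<inter> space M | S. S \<in> sets borel}"

text \<open>
  The data \<open>n\<close>, \<open>\<tau>\<close>, \<open>\<xi>\<close> encode the simple predictable process that equals \<open>\<xi> i\<close> on the time
  interval \<open>(\<tau> i, \<tau> (i + 1)]\<close> for \<open>i < n\<close>, and vanishes elsewhere.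
\<close>

definition simple_process ::
  "(real \<Rightarrow> 'a measure) \<Rightarrow> nat \<Rightarrow> (nat \<Rightarrow> real) \<Rightarrow> (nat \<Rightarrow> 'a \<Rightarrow> real) \<Rightarrow> bool" where
  "simple_process F n \<tau> \<xi> \<longleftrightarrow>
     (\<forall>i\<le>n. \<tau> i \<in> {0..1}) \<and>
     (\<forall>i<n. \<tau> i \<le> \<tau> (Suc i) \<and> \<xi> i \<in> borel_measurable (F (\<tau> i)) \<and>
        (\<exists>C. \<forall>\<omega>\<in>space (F (\<tau> i)). \<bar>\<xi> i \<omega>\<bar> \<le> C))"

definition simple_process_value ::
  "nat \<Rightarrow> (nat \<Rightarrow> real) \<Rightarrow> (nat \<Rightarrow> 'a \<Rightarrow> real) \<Rightarrow> real \<Rightarrow> 'a \<Rightarrow> real" where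
  "simple_process_value n \<tau> \<xi> s \<omega> = (\<Sum>i<n. \<xi> i \<omega> * indicator {\<tau> i<..\<tau> (Suc i)} s)"

definition simple_process_integral ::
  "(real \<Rightarrow> 'a \<Rightarrow> real) \<Rightarrow> nat \<Rightarrow> (nat \<Rightarrow> real) \<Rightarrow> (nat \<Rightarrow> 'a \<Rightarrow> real) \<Rightarrow> real \<Rightarrow> 'a \<Rightarrow> real" where
  "simple_process_integral B n \<tau> \<xi> t \<omega> =
     (\<Sum>i<n. \<xi> i \<omega> * (B (min (\<tau> (Suc i)) t) \<omega> - B (min (\<tau> i) t) \<omega>))"

text \<open>
  \<open>ito_integral M F B H I\<close>: the process \<open>I\<close> is a continuous adapted version of
  \<open>t \<mapsto> \<integral>\<^sub>0\<^sup>t H dB\<close> on \<open>[0, 1)\<close>, i.e. of the extension by the Ito isometry of the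
  elementary integral. It covers progressively measurable \<open>H\<close> that are square integrable on
  \<open>[0, T] \<times> \<Omega>\<close> for all \<open>T < 1\<close>, in particular deterministic continuous \<open>H\<close>; no localisation
  is included.
\<close>

definition ito_integral ::
  "'a measure \<Rightarrow> (real \<Rightarrow> 'a measure) \<Rightarrow> (real \<Rightarrow> 'a \<Rightarrow> real) \<Rightarrow>
     (real \<Rightarrow> 'a \<Rightarrow> real) \<Rightarrow> (real \<Rightarrow> 'a \<Rightarrow> real) \<Rightarrow> bool" where
  "ito_integral M F B H I \<longleftrightarrow>
     (\<forall>T\<in>{0..<1}. (\<lambda>(s, \<omega>). H s \<omega>) \<in> borel_measurable (restrict_space borel {0..T} \<Otimes>\<^sub>M F T)) \<and>
     (\<forall>T\<in>{0..<1}. I T \<in> borel_measurable (F T)) \<and>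
     (AE \<omega> in M. continuous_on {0..<1} (\<lambda>t. I t \<omega>)) \<and>
     (\<forall>T\<in>{0..<1}. \<exists>n \<tau> \<xi>.
        (\<forall>k::nat. simple_process F (n k) (\<tau> k) (\<xi> k)) \<and>
        (\<lambda>k. \<integral>\<^sup>+\<omega>. (\<integral>\<^sup>+s\<in>{0..T}. ennreal ((H s \<omega> - simple_process_value (n k) (\<tau> k) (\<xi> k) s \<omega>)\<^sup>2) \<partial>lborel) \<partial>M)
          \<longlonglongrightarrow> 0 \<and>
        (\<lambda>k. \<integral>\<^sup>+\<omega>. ennreal ((I T \<omega> - simple_process_integral B (n k) (\<tau> k) (\<xi> k) T \<omega>)\<^sup>2) \<partial>M)
          \<longlonglongrightarrow> 0)"

text \<open>
  \<open>augmented_filtration M B t\<close> is generated by \<open>B s\<close>, \<open>0 \<le> s \<le> t\<close>, and the null sets of \<open>M\<close>.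
\<close>

definition augmented_filtration ::
  "'a measure \<Rightarrow> (real \<Rightarrow> 'a \<Rightarrow> real) \<Rightarrow> real \<Rightarrow> 'a measure" where
  "augmented_filtration M B t =
     sigma (space M) ({B s -` S \<inter> space M | s S. s \<in> {0..t} \<and> S \<in> sets borel} \<union> null_sets M)"

text \<open>
  Strong solutions on \<open>[0, 1)\<close> of \<open>dX\<^sub>t = b(t, X\<^sub>t) dt + a(t, X\<^sub>t) dB\<^sub>t\<close>, \<open>X\<^sub>0 = x\<close>, driven by the given \<open>B\<close>:
  continuous, adapted to the augmented filtration of \<open>B\<close>, and satisfying the integral equation.
\<close>

definition strong_solution ::
  "'a measure \<Rightarrow> (real \<Rightarrow> 'a measure) \<Rightarrow> (real \<Rightarrow> 'a \<Rightarrow> real) \<Rightarrow>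
     (real \<Rightarrow> real \<Rightarrow> real) \<Rightarrow> (real \<Rightarrow> real \<Rightarrow> real) \<Rightarrow> real \<Rightarrow> (real \<Rightarrow> 'a \<Rightarrow> real) \<Rightarrow> bool" where
  "strong_solution M F B b a x X \<longleftrightarrow>
     (\<forall>t\<in>{0..<1}. X t \<in> borel_measurable (augmented_filtration M B t)) \<and>
     (AE \<omega> in M. continuous_on {0..<1} (\<lambda>t. X t \<omega>)) \<and>
     (AE \<omega> in M. X 0 \<omega> = x) \<and>
     (\<exists>I. ito_integral M F B (\<lambda>t \<omega>. a t (X t \<omega>)) I \<and>
        (AE \<omega> in M. \<forall>t\<in>{0..<1}.
           (\<lambda>r. b r (X r \<omega>)) absolutely_integrable_on {0..t} \<and>
           X t \<omega> = x + integral {0..t} (\<lambda>r. b r (X r \<omega>)) + I t \<omega>))"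

definition pinned_diffusions ::
  "'a measure \<Rightarrow> (real \<Rightarrow> real \<Rightarrow> real \<Rightarrow> 'a \<Rightarrow> real) \<Rightarrow> bool" where
  "pinned_diffusions M X \<longleftrightarrow>
     (\<forall>x y. measure M {\<omega> \<in> space M. ((\<lambda>t. X x y t \<omega>) \<longlongrightarrow> y) (at_left 1)} = 1)"

end

theory Submission
  imports Defs
begin

text \<open>
  Subtracting the stochastic integral \<open>I\<^sub>t = \<integral>\<^sub>0\<^sup>t \<sigma> dB\<close> turns the equation into an ordinary linear one, path
  by path. Since \<open>I\<close> is a martingale whose second moments are controlled by \<open>\<integral> \<sigma>\<^sup>2\<close>, the maximal inequality
  on finite sets of times, path continuity and (A2) show that \<open>I\<^sub>t\<close> converges almost surely as \<open>t \<rightarrow> 1\<close>.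
  The remaining claim is deterministic: if \<open>I\<^sub>t \<rightarrow> c\<close> then \<open>E\<^sub>t = X\<^sub>t - y - (I\<^sub>t - c)\<close> solves
  \<open>E' = - h (E + (I - c))\<close>, so up to a term vanishing with \<open>exp (- \<integral> h)\<close> it is an average of \<open>I - c\<close>
  against a kernel whose total mass stays bounded because \<open>h\<close> is bounded below.
\<close>

section \<open>The linear equation along a path\<close>

text \<open>In the explicit solution the noise is \<open>\<phi>(t)\<close> times an integral of
  \<open>\<sigma>/\<phi>\<close>: a vanishing factor against a variance that may explode, to be
  weighed against each other. Working with the integral of \<sigma> alone separates the assumptions:
  its variance is exactly what (A2) bounds, while (A1) enters only through an ordinary differential
  equation. The solution \<open>E\<close> of that equation is differentiable although the paths of X
  are rough, so neither an Ito formula nor integration by parts is involved. Removing the limit c as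
  well leaves a forcing term that is small near time 1. The kernel of the average changes sign where
  h is negative; the lower bound of h limits how far its total variation exceeds its total mass. On
  the probabilistic side, \<open>ito_integral\<close> supplies only L^2 limits, with a separate
  approximating sequence for each time, so second-moment bounds and orthogonality of increments to
  the past are carried over from elementary integrals. Constants lost on the way are harmless, since
  the bounds only have to tend to 0.\<close>

lemma integral_has_real_derivative_at:
  fixes g :: "real \<Rightarrow> real"
  assumes "continuous_on {0..<b} g" "0 < t" "t < b"
  shows "((\<lambda>x. integral {0..x} g) has_real_derivative g t) (at t)"
proof -
  define u where "u = (t + b) / 2"
  have u: "t < u" "u < b" using assms by (auto simp: u_def)
  have "((\<lambda>x. integral {0..x} g) has_real_derivative g t) (at t within {0..u})"
    using assms u by (intro integral_has_real_derivative continuous_on_subset[OF assms(1)]) auto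
  moreover have "at t within {0..u} = at t"
    using assms u by (intro at_within_interior) auto
  ultimately show ?thesis by simp
qed

text \<open>
  The comparison function \<open>e exp H (2 exp (K (t - T)) - 1)\<close> has derivative at least \<open>e \<bar>h\<bar> exp H\<close>, because
  \<open>\<bar>h\<bar> \<le> h + 2 K\<close>; it therefore dominates the variation of \<open>E exp H\<close>.
\<close>

lemma weighted_exp_bound:
  fixes E g H h :: "real \<Rightarrow> real"
  assumes "T \<le> t" "0 \<le> e" "0 \<le> K"
    and E: "\<And>r. T \<le> r \<Longrightarrow> r \<le> t \<Longrightarrow> (E has_real_derivative - h r * (E r + g r)) (at r)"
    and H: "\<And>r. T \<le> r \<Longrightarrow> r \<le> t \<Longrightarrow> (H has_real_derivative h r) (at r)"
    and g: "\<And>r. T \<le> r \<Longrightarrow> r \<le> t \<Longrightarrow> \<bar>g r\<bar> \<le> e"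
    and h: "\<And>r. T \<le> r \<Longrightarrow> r \<le> t \<Longrightarrow> - K \<le> h r"
  shows "\<bar>E t\<bar> \<le> \<bar>E T\<bar> * exp (H T - H t) + 2 * e * exp (K * (t - T))"
proof -
  \<comment> \<open>Write \<open>R\<close> as e exp H w. The weight w = 2 exp (K (r - T)) - 1 solves
    w' = K (w + 1) with w = 1 at T; since w \<ge> 1 and h + K \<ge> 0, this gives w' + h w = (h + K)
    w + K \<ge> h + 2 K \<ge> |h|.\<close>
  define R where "R = (\<lambda>r. e * (exp (H r) * (2 * exp (K * (r - T)) - 1)))"
  define G where "G = (\<lambda>r. E r * exp (H r))"
  have dG: "(G has_real_derivative - h r * g r * exp (H r)) (at r)" if "T \<le> r" "r \<le> t" for r
    unfolding G_def using that
    by (auto intro!: derivative_eq_intros E H simp: algebra_simps)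
  have dR: "(R has_real_derivative e * exp (H r) * (h r * (2 * exp (K * (r - T)) - 1) + 2 * K * exp (K * (r - T)))) (at r)"
    if "T \<le> r" "r \<le> t" for r
    unfolding R_def using that
    by (auto intro!: derivative_eq_intros E H simp: algebra_simps)
  have main: "\<bar>h r * g r * exp (H r)\<bar> \<le> e * exp (H r) * (h r * (2 * exp (K * (r - T)) - 1) + 2 * K * exp (K * (r - T)))"
    if r: "T \<le> r" "r \<le> t" for r
  proof -
    define p where "p = exp (K * (r - T)) - 1"
    have p: "0 \<le> p" using r assms by (simp add: p_def)
    have "\<bar>h r\<bar> \<le> h r + 2 * K" using h[OF r] assms(3) by auto
    also have "\<dots> \<le> h r + 2 * K + 2 * ((h r + K) * p)"
      using h[OF r] p by simp
    also have "\<dots> = h r * (2 * exp (K * (r - T)) - 1) + 2 * K * exp (K * (r - T))"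
      by (simp add: p_def algebra_simps)
    finally have a: "\<bar>h r\<bar> \<le> h r * (2 * exp (K * (r - T)) - 1) + 2 * K * exp (K * (r - T))" .
    have "\<bar>h r * g r * exp (H r)\<bar> = \<bar>g r\<bar> * exp (H r) * \<bar>h r\<bar>" by (simp add: abs_mult)
    also have "\<dots> \<le> e * exp (H r) * \<bar>h r\<bar>"
      using g[OF r] by (intro mult_right_mono) auto
    also have "\<dots> \<le> e * exp (H r) * (h r * (2 * exp (K * (r - T)) - 1) + 2 * K * exp (K * (r - T)))"
      using a assms(2) by (intro mult_left_mono) auto
    finally show ?thesis .
  qed
  \<comment> \<open>Monotonicity of both \<open>R - G\<close> and \<open>R + G\<close> amounts to |G
    t - G T| \<le> R t - R T, without any integral being formed.\<close>
  have 1: "R T - G T \<le> R t - G t"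
  proof (rule DERIV_nonneg_imp_nondecreasing[OF assms(1)], intro exI conjI)
    fix r assume r: "T \<le> r" "r \<le> t"
    show "((\<lambda>r. R r - G r) has_real_derivative e * exp (H r) * (h r * (2 * exp (K * (r - T)) - 1) + 2 * K * exp (K * (r - T))) - (- h r * g r * exp (H r))) (at r)" by (rule DERIV_diff[OF dR[OF r] dG[OF r]])
    show "0 \<le> e * exp (H r) * (h r * (2 * exp (K * (r - T)) - 1) + 2 * K * exp (K * (r - T))) - (- h r * g r * exp (H r))"
      using main[OF r] by (simp add: abs_le_iff)
  qed
  have 2: "R T + G T \<le> R t + G t"
  proof (rule DERIV_nonneg_imp_nondecreasing[OF assms(1)], intro exI conjI)
    fix r assume r: "T \<le> r" "r \<le> t"
    show "((\<lambda>r. R r + G r) has_real_derivative e * exp (H r) * (h r * (2 * exp (K * (r - T)) - 1) + 2 * K * exp (K * (r - T))) + (- h r * g r * exp (H r))) (at r)" by (rule DERIV_add[OF dR[OF r] dG[OF r]])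
    show "0 \<le> e * exp (H r) * (h r * (2 * exp (K * (r - T)) - 1) + 2 * K * exp (K * (r - T))) + (- h r * g r * exp (H r))"
      using main[OF r] by (simp add: abs_le_iff)
  qed
  have RT: "0 \<le> R T" using assms(2) by (simp add: R_def)
  have "\<bar>G t\<bar> \<le> \<bar>G T\<bar> + R t" using 1 2 RT by linarith
  also have "R t \<le> e * (exp (H t) * (2 * exp (K * (t - T))))"
    unfolding R_def using assms(2) by (intro mult_left_mono) auto
  finally have "\<bar>G t\<bar> * exp (- H t) \<le> (\<bar>G T\<bar> + e * (exp (H t) * (2 * exp (K * (t - T))))) * exp (- H t)"
    by (intro mult_right_mono) auto
  moreover have "\<bar>G t\<bar> * exp (- H t) = \<bar>E t\<bar>" by (simp add: G_def abs_mult exp_minus)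
  moreover have "(\<bar>G T\<bar> + e * (exp (H t) * (2 * exp (K * (t - T))))) * exp (- H t)
      = \<bar>E T\<bar> * exp (H T - H t) + 2 * e * exp (K * (t - T))"
    by (simp add: G_def abs_mult exp_minus exp_diff field_simps)
  ultimately show ?thesis by simp
qed

text \<open>The value of \<open>E\<close> at a fixed time T, and with it the initial value x, is
  damped by exp (H T - H t), which (A1) sends to 0. What remains is proportional to the size of i -
  c after T, with a factor depending only on the lower bound of h.\<close>

lemma linear_equation_pinned:
  fixes h z i :: "real \<Rightarrow> real"
  assumes h: "continuous_on {0..<1} h" and z: "continuous_on {0..<1} z"
    and eq: "\<And>t. t \<in> {0..<1} \<Longrightarrow> z t = x + integral {0..t} (\<lambda>r. h r * (y - z r)) + i t"
    and i: "(i \<longlongrightarrow> c) (at_left 1)"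
    and bdd: "bdd_below (h ` {0..<1})"
    and div: "filterlim (\<lambda>t. integral {0..t} h) at_top (at_left 1)"
  shows "(z \<longlongrightarrow> y) (at_left 1)"
proof -
  define H where "H = (\<lambda>t. integral {0..t} h)"
  \<comment> \<open>This is z - y - (i - c), written through the integral so that its derivative at
    interior times comes from the fundamental theorem of calculus, whatever the regularity of
    \<open>i\<close>.\<close>
  define E where "E = (\<lambda>t. x + integral {0..t} (\<lambda>r. h r * (y - z r)) - y + c)"
  obtain K0 where K0: "\<And>r. r \<in> {0..<1} \<Longrightarrow> K0 \<le> h r" using bdd unfolding bdd_below_def by blast
  define K where "K = max 0 (- K0)"
  have K: "0 \<le> K" "\<And>r. r \<in> {0..<1} \<Longrightarrow> - K \<le> h r" using K0 by (force simp: K_def)+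
  have zE: "z t = E t + (i t - c) + y" if "t \<in> {0..<1}" for t
    using eq[OF that] by (simp add: E_def)
  have dH: "(H has_real_derivative h r) (at r)" if "0 < r" "r < 1" for r
    unfolding H_def by (rule integral_has_real_derivative_at[OF h that])
  have dE: "(E has_real_derivative - h r * (E r + (i r - c))) (at r)" if "0 < r" "r < 1" for r
  proof -
    have "((\<lambda>t. integral {0..t} (\<lambda>r. h r * (y - z r))) has_real_derivative h r * (y - z r)) (at r)"
      by (rule integral_has_real_derivative_at[OF _ that]) (intro continuous_intros h z)
    then have "(E has_real_derivative h r * (y - z r)) (at r)"
      unfolding E_def by (auto intro!: derivative_eq_intros)
    then show ?thesis using zE[of r] that by (simp add: algebra_simps)
  qed
  have E0: "(E \<longlongrightarrow> 0) (at_left 1)"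
  proof (rule tendstoI)
    fix d :: real assume d: "0 < d"
    \<comment> \<open>As t - T < 1, the error term 2 e exp (K (t - T)) is at most 2 e exp K = d / 2;
      the other half of d is for the damped value at T.\<close>
    define e where "e = d / (4 * exp K)"
    have e: "0 < e" using d by (simp add: e_def)
    have "\<forall>\<^sub>F t in at_left 1. dist (i t) c < e" using i e by (rule tendstoD)
    then obtain b where b: "b < 1" "\<And>t. b < t \<Longrightarrow> t < 1 \<Longrightarrow> \<bar>i t - c\<bar> < e"
      unfolding eventually_at_left_field dist_real_def by blast
    \<comment> \<open>Strictly positive as well as beyond \<open>b\<close>, because
      \<open>dH\<close> and \<open>dE\<close> hold only at interior times.\<close>
    define T where "T = (max b 0 + 1) / 2"
    have T: "0 < T" "b < T" "T < 1" using b by (auto simp: T_def)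
    have bound: "\<bar>E t\<bar> \<le> \<bar>E T\<bar> * exp (H T - H t) + 2 * e * exp (K * (t - T))" if "T < t" "t < 1" for t
      by (rule weighted_exp_bound[where h = h and g = "\<lambda>r. i r - c"])
         (use that T e K b in \<open>auto intro: less_imp_le dH dE[simplified]\<close>)
    have "((\<lambda>t. \<bar>E T\<bar> * exp (H T) * exp (- H t)) \<longlongrightarrow> \<bar>E T\<bar> * exp (H T) * 0) (at_left 1)"
      using div unfolding H_def[symmetric]
      by (intro tendsto_intros filterlim_compose[OF exp_at_bot])
         (simp add: filterlim_uminus_at_bot)
    then have "\<forall>\<^sub>F t in at_left 1. \<bar>E T\<bar> * exp (H T) * exp (- H t) < d / 2"
      using d by (auto dest: order_tendstoD(2)[of _ _ _ "d / 2"])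
    moreover have "\<forall>\<^sub>F t in at_left 1. T < t \<and> t < (1::real)"
      using T by (auto intro: eventually_at_leftI)
    ultimately show "\<forall>\<^sub>F t in at_left 1. dist (E t) 0 < d"
    proof eventually_elim
      case (elim t)
      have "K * (t - T) \<le> K * 1" using elim T K by (intro mult_left_mono) auto
      then have "2 * e * exp (K * (t - T)) \<le> 2 * e * exp K" using e by simp
      also have "\<dots> = d / 2" by (simp add: e_def)
      finally have "\<bar>E t\<bar> \<le> \<bar>E T\<bar> * exp (H T - H t) + d / 2" using bound[of t] elim by simp
      moreover have "\<bar>E T\<bar> * exp (H T - H t) = \<bar>E T\<bar> * exp (H T) * exp (- H t)"
        by (simp add: exp_diff exp_minus divide_inverse)
      ultimately show ?case using elim by simp
    qed
  qed
  have "((\<lambda>t. E t + (i t - c) + y) \<longlongrightarrow> 0 + (c - c) + y) (at_left 1)"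
    by (intro tendsto_intros E0 i)
  moreover have "\<forall>\<^sub>F t in at_left 1. z t = E t + (i t - c) + y"
    by (rule eventually_at_leftI[of 0]) (auto intro: zE)
  ultimately show ?thesis by (simp add: tendsto_cong)
qed

section \<open>Increments of Brownian motion\<close>

text \<open>Passes from the form of independence in \<open>brownian_motion\<close> to the one that
  the product rules for expectations accept. The preimages under Z are already a sigma-algebra, and
  independence survives shrinking \<open>sets N\<close> to the events generated by Y.\<close>

lemma (in prob_space) indep_var_of_indep_set:
  assumes sub: "subalgebra M N" and Y: "Y \<in> borel_measurable N" and Z: "Z \<in> borel_measurable M"
    and ind: "indep_set (sets N) {Z -` S \<inter> space M | S. S \<in> sets borel}"
  shows "indep_var borel Y borel (Z :: 'a \<Rightarrow> real)"
  unfolding indep_var_eq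
proof (intro conjI)
  show YM: "Y \<in> borel_measurable M" using measurable_from_subalg[OF sub Y] .
  show "Z \<in> borel_measurable M" by fact
  have "sigma_sets (space M) {Y -` A \<inter> space M |A. A \<in> sets borel} \<subseteq> sets N"
  proof -
    have "{Y -` A \<inter> space M |A. A \<in> sets borel} \<subseteq> sets N"
      using measurable_sets[OF Y] sub by (auto simp: subalgebra_def)
    then show ?thesis using sets.sigma_sets_subset[of _ N] sub by (simp add: subalgebra_def)
  qed
  moreover have eq: "sigma_sets (space M) {Z -` A \<inter> space M |A. A \<in> sets borel} = {Z -` A \<inter> space M |A. A \<in> sets borel}"
    using sets.sigma_sets_eq[of "vimage_algebra (space M) Z borel"] sets_vimage_algebra2[of Z "space M" borel]
    by simp
  ultimately show "indep_set (sigma_sets (space M) {Y -` A \<inter> space M |A. A \<in> sets borel})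
      (sigma_sets (space M) {Z -` A \<inter> space M |A. A \<in> sets borel})"
    using ind unfolding indep_sets2_eq eq by blast
qed

lemma (in prob_space) centred_normal_moments:
  assumes "0 < s" and D: "distributed M lborel Z (normal_density 0 s)"
  shows "integrable M Z" "expectation Z = 0" "integrable M (\<lambda>\<omega>. (Z \<omega>)\<^sup>2)" "expectation (\<lambda>\<omega>. (Z \<omega>)\<^sup>2) = s\<^sup>2"
proof -
  show E: "expectation Z = 0" by (rule normal_distributed_expectation[OF assms])
  show "integrable M Z"
    using distributed_integrable[OF D, of "\<lambda>x. x"] integrable_normal_moment_nz_1[OF assms(1), of 0]
    by (simp add: normal_density_nonneg)
  show "integrable M (\<lambda>\<omega>. (Z \<omega>)\<^sup>2)"
    using distributed_integrable[OF D, of "\<lambda>x. x\<^sup>2"] integrable_normal_moment[OF assms(1), of 0 2]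
    by (simp add: normal_density_nonneg)
  show "expectation (\<lambda>\<omega>. (Z \<omega>)\<^sup>2) = s\<^sup>2"
    using normal_distributed_variance[OF assms] E by simp
qed

context brownian_motion
begin

lemma measurable_F_mono:
  assumes "0 \<le> s" "s \<le> t" "t \<le> 1" "f \<in> borel_measurable (F s)"
  shows "f \<in> borel_measurable (F t)"
proof -
  have "space (F s) = space (F t)" 
    using subalgebra_F[of s] subalgebra_F[of t] assms(1-3) by (simp add: subalgebra_def)
  then show ?thesis
    using assms F_mono[of s t] by (auto simp: measurable_def)
qed

lemma measurable_F:
  assumes "t \<in> {0..1}" "f \<in> borel_measurable (F t)"
  shows "f \<in> borel_measurable M"
  using measurable_from_subalg[OF subalgebra_F] assms by blast

lemma measurable_B: "t \<in> {0..1} \<Longrightarrow> B t \<in> borel_measurable M"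
  using adapted_B measurable_F by blast

lemma measurable_B_F: "0 \<le> s \<Longrightarrow> s \<le> t \<Longrightarrow> t \<le> 1 \<Longrightarrow> B s \<in> borel_measurable (F t)"
  using adapted_B measurable_F_mono by (meson atLeastAtMost_iff order_trans)

text \<open>The single point at which the law and the independence of Brownian increments enter; all
  later moment computations reduce to it. Y is merely integrable, because it will itself contain
  earlier increments. The case s = t stands apart since \<open>normal_increments\<close> speaks only
  of s < t.\<close>

lemma increment_product:
  assumes st: "0 \<le> s" "s \<le> t" "t \<le> 1" and Y: "Y \<in> borel_measurable (F s)" "integrable M Y"
  shows "has_bochner_integral M (\<lambda>\<omega>. Y \<omega> * (B t \<omega> - B s \<omega>)) 0"
    and "has_bochner_integral M (\<lambda>\<omega>. Y \<omega> * (B t \<omega> - B s \<omega>)\<^sup>2) (expectation Y * (t - s))"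
proof -
  have "has_bochner_integral M (\<lambda>\<omega>. Y \<omega> * (B t \<omega> - B s \<omega>)) 0 \<and>
    has_bochner_integral M (\<lambda>\<omega>. Y \<omega> * (B t \<omega> - B s \<omega>)\<^sup>2) (expectation Y * (t - s))"
  proof (cases "s = t")
    case True then show ?thesis by (simp add: has_bochner_integral_zero)
  next
    case False
    then have lt: "s < t" using st by simp
    let ?Z = "\<lambda>\<omega>. B t \<omega> - B s \<omega>"
    have Z: "?Z \<in> borel_measurable M" using st by (auto intro!: borel_measurable_diff measurable_B)
    have ind: "indep_var borel Y borel ?Z"
      using st Y Z independent_increments[OF st(1) lt st(3)]
      by (intro indep_var_of_indep_set[OF subalgebra_F]) auto
    have ind2: "indep_var borel Y borel (\<lambda>\<omega>. (?Z \<omega>)\<^sup>2)"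
      using indep_var_compose[OF ind, of "\<lambda>x. x" borel "\<lambda>x. x\<^sup>2" borel] by (simp add: comp_def)
    note m = centred_normal_moments[OF _ normal_increments[OF st(1) lt st(3)]]
    have pos: "0 < sqrt (t - s)" using lt by simp
    show ?thesis
      unfolding has_bochner_integral_iff
      using indep_var_integrable[OF ind Y(2) m(1)[OF pos]] indep_var_lebesgue_integral[OF ind Y(2) m(1)[OF pos]]
       indep_var_integrable[OF ind2 Y(2) m(3)[OF pos]] indep_var_lebesgue_integral[OF ind2 Y(2) m(3)[OF pos]]
       m(2)[OF pos] m(4)[OF pos] st by simp
  qed
  then show "has_bochner_integral M (\<lambda>\<omega>. Y \<omega> * (B t \<omega> - B s \<omega>)) 0"
    and "has_bochner_integral M (\<lambda>\<omega>. Y \<omega> * (B t \<omega> - B s \<omega>)\<^sup>2) (expectation Y * (t - s))" by auto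
qed

text \<open>Cut the two intervals at c and at m = min b d. Only the common piece from c to m
  contributes, through the second moment of its increment. In every other product the later
  increment is independent of all remaining factors, the weights \<xi> and \<eta> being known at
  time c, and has mean 0.\<close>

lemma covariance_ordered:
  assumes ab: "0 \<le> a" "a \<le> b" "b \<le> 1" and cd: "c \<le> d" "d \<le> 1" and ac: "a \<le> c"
    and \<xi>: "\<xi> \<in> borel_measurable (F a)" "\<And>\<omega>. \<omega> \<in> space M \<Longrightarrow> \<bar>\<xi> \<omega>\<bar> \<le> C"
    and \<eta>: "\<eta> \<in> borel_measurable (F c)" "\<And>\<omega>. \<omega> \<in> space M \<Longrightarrow> \<bar>\<eta> \<omega>\<bar> \<le> C'"
  shows "has_bochner_integral M (\<lambda>\<omega>. (\<xi> \<omega> * (B b \<omega> - B a \<omega>)) * (\<eta> \<omega> * (B d \<omega> - B c \<omega>)))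
    (expectation (\<lambda>\<omega>. \<xi> \<omega> * \<eta> \<omega>) * max 0 (min b d - max a c))"
proof -
  have c0: "0 \<le> c" using ab ac by simp
  have \<xi>F: "\<xi> \<in> borel_measurable (F t)" if "a \<le> t" "t \<le> 1" for t
    using measurable_F_mono[OF ab(1) that \<xi>(1)] .
  have \<eta>F: "\<eta> \<in> borel_measurable (F t)" if "c \<le> t" "t \<le> 1" for t
    using measurable_F_mono[OF c0 that \<eta>(1)] .
  have bd: "\<bar>\<xi> \<omega> * \<eta> \<omega>\<bar> \<le> C * C'" if "\<omega> \<in> space M" for \<omega>
    unfolding abs_mult using \<xi>(2)[OF that] \<eta>(2)[OF that] by (intro mult_mono) auto
  have \<xi>\<eta>F: "(\<lambda>\<omega>. \<xi> \<omega> * \<eta> \<omega>) \<in> borel_measurable (F t)" if "c \<le> t" "t \<le> 1" for t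
    using \<xi>F[of t] \<eta>F[of t] that ac by (auto intro: borel_measurable_times)
  have \<xi>\<eta>M: "(\<lambda>\<omega>. \<xi> \<omega> * \<eta> \<omega>) \<in> borel_measurable M"
    using \<xi>\<eta>F[of c] cd c0 by (intro measurable_F[of c]) auto
  have int: "integrable M (\<lambda>\<omega>. \<xi> \<omega> * \<eta> \<omega>)"
    using bd by (intro integrable_const_bound[of _ "C * C'"] \<xi>\<eta>M) auto
  have incr: "integrable M (\<lambda>\<omega>. B v \<omega> - B u \<omega>)" if "0 \<le> u" "u \<le> v" "v \<le> 1" for u v
  proof -
    have "has_bochner_integral M (\<lambda>\<omega>. 1 * (B v \<omega> - B u \<omega>)) 0"
      using that by (intro increment_product(1)) auto
    then show ?thesis by (simp add: has_bochner_integral_iff)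
  qed
  have int2: "integrable M (\<lambda>\<omega>. (\<xi> \<omega> * \<eta> \<omega>) * (B v \<omega> - B u \<omega>))" if "0 \<le> u" "u \<le> v" "v \<le> 1" for u v
  proof (rule Bochner_Integration.integrable_bound[OF integrable_mult_right[OF incr[OF that], of "C * C'"]])
    show "(\<lambda>\<omega>. (\<xi> \<omega> * \<eta> \<omega>) * (B v \<omega> - B u \<omega>)) \<in> borel_measurable M"
      using that by (intro borel_measurable_times borel_measurable_diff measurable_B \<xi>\<eta>M) auto
    show "AE \<omega> in M. norm ((\<xi> \<omega> * \<eta> \<omega>) * (B v \<omega> - B u \<omega>)) \<le> norm ((C * C') * (B v \<omega> - B u \<omega>))"
    proof (rule AE_I2)
      fix \<omega> assume "\<omega> \<in> space M"
      from bd[OF this] have "\<bar>\<xi> \<omega> * \<eta> \<omega>\<bar> \<le> \<bar>C * C'\<bar>" by simp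
      then show "norm ((\<xi> \<omega> * \<eta> \<omega>) * (B v \<omega> - B u \<omega>)) \<le> norm ((C * C') * (B v \<omega> - B u \<omega>))"
        unfolding real_norm_def abs_mult[of _ "B v \<omega> - B u \<omega>"] by (rule mult_right_mono) simp
    qed
  qed
  have past: "has_bochner_integral M (\<lambda>\<omega>. ((\<xi> \<omega> * \<eta> \<omega>) * (B v \<omega> - B u \<omega>)) * (B q \<omega> - B p \<omega>)) 0"
    if "0 \<le> u" "u \<le> v" "v \<le> p" "c \<le> p" "p \<le> q" "q \<le> 1" for u v p q
  proof (rule increment_product(1))
    show "(\<lambda>\<omega>. (\<xi> \<omega> * \<eta> \<omega>) * (B v \<omega> - B u \<omega>)) \<in> borel_measurable (F p)"
      using that by (intro borel_measurable_times[OF \<xi>\<eta>F] borel_measurable_diff measurable_B_F) auto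
    show "integrable M (\<lambda>\<omega>. (\<xi> \<omega> * \<eta> \<omega>) * (B v \<omega> - B u \<omega>))"
      using that by (intro int2) auto
  qed (use that in auto)
  show ?thesis
  proof (cases "b \<le> c")
    case True
    have "max 0 (min b d - max a c) = 0" using True ac by auto
    moreover have "has_bochner_integral M (\<lambda>\<omega>. ((\<xi> \<omega> * \<eta> \<omega>) * (B b \<omega> - B a \<omega>)) * (B d \<omega> - B c \<omega>)) 0"
      using True ab cd by (intro past) auto
    ultimately show ?thesis by (simp add: mult_ac)
  next
    case False
    define m where "m = min b d"
    have m: "c \<le> m" "m \<le> b" "m \<le> d" "m = b \<or> m = d" "m \<le> 1"
      using False ab cd unfolding m_def by auto
    have eq: "max 0 (min b d - max a c) = m - c" using False ac m by (simp add: m_def)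
    have 1: "has_bochner_integral M (\<lambda>\<omega>. ((\<xi> \<omega> * \<eta> \<omega>) * (B c \<omega> - B a \<omega>)) * (B d \<omega> - B c \<omega>)) 0"
      using ab ac cd c0 by (intro past) auto
    have 2: "has_bochner_integral M (\<lambda>\<omega>. (\<xi> \<omega> * \<eta> \<omega>) * (B m \<omega> - B c \<omega>)\<^sup>2) (expectation (\<lambda>\<omega>. \<xi> \<omega> * \<eta> \<omega>) * (m - c))"
      using m c0 by (intro increment_product(2) int \<xi>\<eta>F) auto
    have 3: "has_bochner_integral M (\<lambda>\<omega>. ((\<xi> \<omega> * \<eta> \<omega>) * (B m \<omega> - B c \<omega>)) * (B d \<omega> - B m \<omega>)) 0"
      using m c0 cd by (intro past) auto
    have 4: "has_bochner_integral M (\<lambda>\<omega>. ((\<xi> \<omega> * \<eta> \<omega>) * (B m \<omega> - B c \<omega>)) * (B b \<omega> - B m \<omega>)) 0"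
      using m c0 ab by (intro past) auto
    have "has_bochner_integral M (\<lambda>\<omega>. ((\<xi> \<omega> * \<eta> \<omega>) * (B c \<omega> - B a \<omega>)) * (B d \<omega> - B c \<omega>) + ((\<xi> \<omega> * \<eta> \<omega>) * (B m \<omega> - B c \<omega>)\<^sup>2
        + (((\<xi> \<omega> * \<eta> \<omega>) * (B m \<omega> - B c \<omega>)) * (B d \<omega> - B m \<omega>) + ((\<xi> \<omega> * \<eta> \<omega>) * (B m \<omega> - B c \<omega>)) * (B b \<omega> - B m \<omega>))))
       (0 + (expectation (\<lambda>\<omega>. \<xi> \<omega> * \<eta> \<omega>) * (m - c) + (0 + 0)))"
      by (intro has_bochner_integral_add 1 2 3 4)
    \<comment> \<open>Expanding at c and m leaves one further product, (Bb - Bm) (Bd - Bm). It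
      vanishes because m is one of the two right end points.\<close>
    moreover have *: "x * y * (Bc - Ba) * (Bd - Bc) + (x * y * (Bm - Bc)\<^sup>2 + (x * y * (Bm - Bc) * (Bd - Bm) + x * y * (Bm - Bc) * (Bb - Bm)))
       = (x * (Bb - Ba)) * (y * (Bd - Bc))" if "Bm = Bb \<or> Bm = Bd" for x y Ba Bb Bc Bd Bm :: real
      using that by (elim disjE) (simp_all add: power2_eq_square algebra_simps)
    have "((\<xi> \<omega> * \<eta> \<omega>) * (B c \<omega> - B a \<omega>)) * (B d \<omega> - B c \<omega>) + ((\<xi> \<omega> * \<eta> \<omega>) * (B m \<omega> - B c \<omega>)\<^sup>2
        + (((\<xi> \<omega> * \<eta> \<omega>) * (B m \<omega> - B c \<omega>)) * (B d \<omega> - B m \<omega>) + ((\<xi> \<omega> * \<eta> \<omega>) * (B m \<omega> - B c \<omega>)) * (B b \<omega> - B m \<omega>)))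
       = (\<xi> \<omega> * (B b \<omega> - B a \<omega>)) * (\<eta> \<omega> * (B d \<omega> - B c \<omega>))" for \<omega>
      by (rule *) (use m(4) in auto)
    ultimately show ?thesis unfolding eq by simp
  qed
qed

text \<open>Measurability is asked only for nondegenerate intervals: clipping a grid to [s, t] can
  move a left end point down to t, before its coefficient is known, but then the clipped interval is
  empty and the product is 0.\<close>

lemma covariance:
  assumes ab: "0 \<le> a" "a \<le> b" "b \<le> 1" and cd: "0 \<le> c" "c \<le> d" "d \<le> 1"
    and \<xi>: "a < b \<Longrightarrow> \<xi> \<in> borel_measurable (F a)" "\<And>\<omega>. \<omega> \<in> space M \<Longrightarrow> \<bar>\<xi> \<omega>\<bar> \<le> C"
    and \<eta>: "c < d \<Longrightarrow> \<eta> \<in> borel_measurable (F c)" "\<And>\<omega>. \<omega> \<in> space M \<Longrightarrow> \<bar>\<eta> \<omega>\<bar> \<le> C'"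
  shows "has_bochner_integral M (\<lambda>\<omega>. (\<xi> \<omega> * (B b \<omega> - B a \<omega>)) * (\<eta> \<omega> * (B d \<omega> - B c \<omega>)))
    (expectation (\<lambda>\<omega>. \<xi> \<omega> * \<eta> \<omega>) * max 0 (min b d - max a c))"
proof -
  consider "a = b" | "c = d" | "a < b" "c < d" "a \<le> c" | "a < b" "c < d" "c \<le> a" using ab cd by linarith
  then show ?thesis
  proof cases
    case 1
    then have "max 0 (min b d - max a c) = 0" by auto
    with 1 show ?thesis by (simp add: has_bochner_integral_zero)
  next
    case 2
    then have "max 0 (min b d - max a c) = 0" by auto
    with 2 show ?thesis by (simp add: has_bochner_integral_zero)
  next
    case 3
    then show ?thesis using covariance_ordered[OF ab cd(2,3) _ \<xi>(1) \<xi>(2) \<eta>(1) \<eta>(2)] by simp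
  next
    case 4
    then show ?thesis using covariance_ordered[OF cd ab(2,3) _ \<eta>(1) \<eta>(2) \<xi>(1) \<xi>(2)]
      by (simp add: mult.commute min.commute max.commute)
  qed
qed

end

section \<open>Isometry for elementary integrals\<close>

text \<open>Taken in \<open>ennreal\<close>, in line with the limits in \<open>ito_integral\<close>,
  so that estimates can precede any proof of square integrability.\<close>

definition mean_sq :: "'b measure \<Rightarrow> ('b \<Rightarrow> real) \<Rightarrow> ennreal" where
  "mean_sq N f = (\<integral>\<^sup>+x. ennreal ((f x)\<^sup>2) \<partial>N)"

lemma mean_sq_mono:
  "(\<And>x. x \<in> space N \<Longrightarrow> \<bar>f x\<bar> \<le> \<bar>g x\<bar>) \<Longrightarrow> mean_sq N f \<le> mean_sq N g"
  unfolding mean_sq_def by (intro nn_integral_mono ennreal_leI) (simp add: abs_le_square_iff)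

lemma mean_sq_uminus: "mean_sq N (\<lambda>x. - f x) = mean_sq N f"
  by (simp add: mean_sq_def)

text \<open>A crude replacement for Minkowski's inequality, from (a + b)^2 \<le> 2 a^2 + 2 b^2; it
  stays linear in the squared norms.\<close>

lemma mean_sq_add:
  assumes [measurable]: "f \<in> borel_measurable N" "g \<in> borel_measurable N"
  shows "mean_sq N (\<lambda>x. f x + g x) \<le> 2 * mean_sq N f + 2 * mean_sq N g"
proof -
  have "mean_sq N (\<lambda>x. f x + g x) \<le> (\<integral>\<^sup>+x. 2 * ennreal ((f x)\<^sup>2) + 2 * ennreal ((g x)\<^sup>2) \<partial>N)"
    unfolding mean_sq_def
  proof (rule nn_integral_mono)
    fix x
    have "(f x + g x)\<^sup>2 \<le> 2 * (f x)\<^sup>2 + 2 * (g x)\<^sup>2"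
      using zero_le_power2[of "f x - g x"] by (simp add: power2_sum power2_diff)
    then have "ennreal ((f x + g x)\<^sup>2) \<le> ennreal (2 * (f x)\<^sup>2 + 2 * (g x)\<^sup>2)" by (rule ennreal_leI)
    also have "\<dots> = 2 * ennreal ((f x)\<^sup>2) + 2 * ennreal ((g x)\<^sup>2)"
      by (simp add: ennreal_mult ennreal_plus)
    finally show "ennreal ((f x + g x)\<^sup>2) \<le> 2 * ennreal ((f x)\<^sup>2) + 2 * ennreal ((g x)\<^sup>2)" .
  qed
  also have "\<dots> = 2 * mean_sq N f + 2 * mean_sq N g"
    unfolding mean_sq_def by (simp add: nn_integral_add nn_integral_cmult)
  finally show ?thesis .
qed

lemma mean_sq_diff:
  assumes "f \<in> borel_measurable N" "g \<in> borel_measurable N"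
  shows "mean_sq N (\<lambda>x. f x - g x) \<le> 2 * mean_sq N f + 2 * mean_sq N g"
  using mean_sq_add[of f N "\<lambda>x. - g x"] assms by (simp add: mean_sq_uminus)

lemma mean_sq_finite_integrable:
  assumes "f \<in> borel_measurable N" "mean_sq N f < \<infinity>"
  shows "integrable N (\<lambda>x. (f x)\<^sup>2)"
  using assms unfolding mean_sq_def by (intro integrableI_bounded) auto

lemma integrable_mult_mean_sq:
  assumes "f \<in> borel_measurable N" "g \<in> borel_measurable N" "mean_sq N f < \<infinity>" "mean_sq N g < \<infinity>"
  shows "integrable N (\<lambda>x. f x * g x)"
proof (rule Bochner_Integration.integrable_bound)
  show "integrable N (\<lambda>x. (f x)\<^sup>2 + (g x)\<^sup>2)"
    using assms by (intro Bochner_Integration.integrable_add mean_sq_finite_integrable)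
  show "(\<lambda>x. f x * g x) \<in> borel_measurable N" using assms by simp
  have "\<bar>u * v\<bar> \<le> \<bar>u\<^sup>2 + v\<^sup>2\<bar>" for u v :: real
  proof -
    have "0 \<le> (\<bar>u\<bar> - \<bar>v\<bar>)\<^sup>2" by simp
    then have "2 * (\<bar>u\<bar> * \<bar>v\<bar>) \<le> u\<^sup>2 + v\<^sup>2" by (simp add: power2_diff)
    moreover have "0 \<le> \<bar>u\<bar> * \<bar>v\<bar>" by simp
    ultimately show ?thesis unfolding abs_mult by linarith
  qed
  then show "AE x in N. norm (f x * g x) \<le> norm ((f x)\<^sup>2 + (g x)\<^sup>2)" by simp
qed

lemma integral_square_le_mean_sq:
  assumes [measurable]: "f \<in> borel_measurable N" "g \<in> borel_measurable N"
  shows "ennreal ((\<integral>x. f x * g x \<partial>N)\<^sup>2) \<le> mean_sq N f * mean_sq N g"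
proof -
  \<comment> \<open>If the product is not integrable, its Bochner integral is 0 by convention and
    the bound is trivial.\<close>
  have "ennreal \<bar>\<integral>x. f x * g x \<partial>N\<bar> \<le> (\<integral>\<^sup>+x. ennreal \<bar>f x\<bar> * ennreal \<bar>g x\<bar> \<partial>N)"
    using integral_norm_bound_ennreal[of N "\<lambda>x. f x * g x"]
    by (cases "integrable N (\<lambda>x. f x * g x)") (auto simp: abs_mult ennreal_mult not_integrable_integral_eq)
  then have "(ennreal \<bar>\<integral>x. f x * g x \<partial>N\<bar>)\<^sup>2 \<le> (\<integral>\<^sup>+x. ennreal \<bar>f x\<bar> * ennreal \<bar>g x\<bar> \<partial>N)\<^sup>2"
    by (rule power_mono) simp
  also have "\<dots> \<le> (\<integral>\<^sup>+x. (ennreal \<bar>f x\<bar>)\<^sup>2 \<partial>N) * (\<integral>\<^sup>+x. (ennreal \<bar>g x\<bar>)\<^sup>2 \<partial>N)"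
    by (rule Cauchy_Schwarz_nn_integral) auto
  also have "\<dots> = mean_sq N f * mean_sq N g"
    by (simp add: mean_sq_def ennreal_power)
  finally show ?thesis by (simp add: ennreal_power)
qed

lemma has_bochner_integral_interval_overlap:
  fixes a b c d :: real
  shows "has_bochner_integral lborel (\<lambda>r. indicator {a<..b} r * indicator {c<..d} r :: real) (max 0 (min b d - max a c))"
proof -
  have *: "(\<lambda>r. indicator {a<..b} r * indicator {c<..d} r :: real) = indicator {max a c<..min b d}"
    by (auto simp: fun_eq_iff indicator_def)
  show ?thesis
  proof (cases "max a c \<le> min b d")
    case True
    then have "emeasure lborel {max a c<..min b d} < \<infinity>" "measure lborel {max a c<..min b d} = max 0 (min b d - max a c)"
      by (simp_all only: emeasure_lborel_Ioc measure_lborel_Ioc) simp_all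
    with has_bochner_integral_real_indicator[of "{max a c<..min b d}" lborel] show ?thesis
      unfolding * by simp
  next
    case False
    then have "{max a c<..min b d} = {}" by (intro greaterThanAtMost_empty) linarith
    moreover have "max 0 (min b d - max a c) = 0" using False by linarith
    ultimately show ?thesis
      using has_bochner_integral_real_indicator[of "{}" lborel] unfolding * by simp
  qed
qed

text \<open>For s \<le> t this is the projection of u onto [s, t]. Projecting the grid turns the
  increment of an elementary integral from s to t into an elementary integral again.\<close>

definition clip :: "real \<Rightarrow> real \<Rightarrow> real \<Rightarrow> real" where
  "clip s t u = max s (min u t)"

context brownian_motion
begin

text \<open>The intervals may overlap, so that the difference of two simple processes needs no common refinement.\<close>

lemma elementary_isometry:
  fixes \<xi> :: "'i \<Rightarrow> 'a \<Rightarrow> real"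
  assumes S: "finite S"
    and ab: "\<And>i. i \<in> S \<Longrightarrow> 0 \<le> a i \<and> a i \<le> b i \<and> b i \<le> 1"
    and \<xi>F: "\<And>i. i \<in> S \<Longrightarrow> a i < b i \<Longrightarrow> \<xi> i \<in> borel_measurable (F (a i))"
    and \<xi>M: "\<And>i. i \<in> S \<Longrightarrow> \<xi> i \<in> borel_measurable M"
    and bdd: "\<And>i. i \<in> S \<Longrightarrow> \<exists>C. \<forall>\<omega>\<in>space M. \<bar>\<xi> i \<omega>\<bar> \<le> C"
  shows "mean_sq M (\<lambda>\<omega>. \<Sum>i\<in>S. \<xi> i \<omega> * (B (b i) \<omega> - B (a i) \<omega>)) =
    mean_sq (M \<Otimes>\<^sub>M lborel) (\<lambda>(\<omega>, r). \<Sum>i\<in>S. \<xi> i \<omega> * indicator {a i<..b i} r)"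
proof -
  define ov where "ov = (\<lambda>i j. max 0 (min (b i) (b j) - max (a i) (a j)))"
  \<comment> \<open>The common value of both sides. Expanding the squares, the left side yields it
    by \<open>covariance\<close>, the right side by integrating first in r, where the products of
    indicators have integral \<open>ov i j\<close>.\<close>
  define V where "V = (\<Sum>i\<in>S. \<Sum>j\<in>S. expectation (\<lambda>\<omega>. \<xi> i \<omega> * \<xi> j \<omega>) * ov i j)"
  obtain C where C: "\<And>i \<omega>. i \<in> S \<Longrightarrow> \<omega> \<in> space M \<Longrightarrow> \<bar>\<xi> i \<omega>\<bar> \<le> C i"
    using bdd by metis
  have L: "has_bochner_integral M (\<lambda>\<omega>. (\<Sum>i\<in>S. \<xi> i \<omega> * (B (b i) \<omega> - B (a i) \<omega>))\<^sup>2) V"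
    unfolding power2_eq_square sum_product V_def ov_def
  proof (intro has_bochner_integral_sum)
    fix i j assume "i \<in> S" "j \<in> S"
    then show "has_bochner_integral M (\<lambda>\<omega>. \<xi> i \<omega> * (B (b i) \<omega> - B (a i) \<omega>) * (\<xi> j \<omega> * (B (b j) \<omega> - B (a j) \<omega>)))
        (expectation (\<lambda>\<omega>. \<xi> i \<omega> * \<xi> j \<omega>) * max 0 (min (b i) (b j) - max (a i) (a j)))"
      using ab[of i] ab[of j] \<xi>F[of i] \<xi>F[of j] C[of i] C[of j] by (intro covariance) auto
  qed
  have R: "has_bochner_integral lborel (\<lambda>r. (\<Sum>i\<in>S. \<xi> i \<omega> * indicator {a i<..b i} r)\<^sup>2)
      (\<Sum>i\<in>S. \<Sum>j\<in>S. \<xi> i \<omega> * \<xi> j \<omega> * ov i j)" for \<omega>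
    unfolding power2_eq_square sum_product
  proof (intro has_bochner_integral_sum)
    fix i j
    show "has_bochner_integral lborel (\<lambda>r. \<xi> i \<omega> * indicator {a i<..b i} r * (\<xi> j \<omega> * indicator {a j<..b j} r))
        (\<xi> i \<omega> * \<xi> j \<omega> * ov i j)"
      using has_bochner_integral_mult_right[OF has_bochner_integral_interval_overlap[of "a i" "b i" "a j" "b j"], of "\<xi> i \<omega> * \<xi> j \<omega>"]
      by (simp add: ov_def mult_ac)
  qed
  have R2: "has_bochner_integral M (\<lambda>\<omega>. \<Sum>i\<in>S. \<Sum>j\<in>S. \<xi> i \<omega> * \<xi> j \<omega> * ov i j) V"
    unfolding V_def
  proof (intro has_bochner_integral_sum has_bochner_integral_mult_left has_bochner_integral_integrable)
    fix i j assume ij: "i \<in> S" "j \<in> S"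
    show "integrable M (\<lambda>\<omega>. \<xi> i \<omega> * \<xi> j \<omega>)"
    proof (rule integrable_const_bound[of _ "C i * C j"])
      show "AE \<omega> in M. norm (\<xi> i \<omega> * \<xi> j \<omega>) \<le> C i * C j"
      proof (rule AE_I2)
        fix \<omega> assume \<omega>: "\<omega> \<in> space M"
        show "norm (\<xi> i \<omega> * \<xi> j \<omega>) \<le> C i * C j"
          unfolding real_norm_def abs_mult
          using C[OF ij(1) \<omega>] C[OF ij(2) \<omega>] by (intro mult_mono) auto
      qed
      show "(\<lambda>\<omega>. \<xi> i \<omega> * \<xi> j \<omega>) \<in> borel_measurable M" using \<xi>M ij by simp
    qed
  qed
  \<comment> \<open>The double sum has terms of either sign; it is nonnegative as the integral of a
    square, which is what the passage to \<open>ennreal\<close> requires.\<close>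
  have Rnonneg: "0 \<le> (\<Sum>i\<in>S. \<Sum>j\<in>S. \<xi> i \<omega> * \<xi> j \<omega> * ov i j)" for \<omega>
    using has_bochner_integral_integral_eq[OF R[of \<omega>]] Bochner_Integration.integral_nonneg[of lborel "\<lambda>r. (\<Sum>i\<in>S. \<xi> i \<omega> * indicator {a i<..b i} r)\<^sup>2"] by simp
  have meas: "(\<lambda>(\<omega>, r). ennreal ((\<Sum>i\<in>S. \<xi> i \<omega> * indicator {a i<..b i} r)\<^sup>2)) \<in> borel_measurable (M \<Otimes>\<^sub>M lborel)"
  proof -
    have [measurable]: "i \<in> S \<Longrightarrow> \<xi> i \<in> borel_measurable M" for i by (rule \<xi>M)
    show ?thesis by measurable
  qed
  have "mean_sq (M \<Otimes>\<^sub>M lborel) (\<lambda>(\<omega>, r). \<Sum>i\<in>S. \<xi> i \<omega> * indicator {a i<..b i} r)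
      = (\<integral>\<^sup>+\<omega>. (\<integral>\<^sup>+r. ennreal ((\<Sum>i\<in>S. \<xi> i \<omega> * indicator {a i<..b i} r)\<^sup>2) \<partial>lborel) \<partial>M)"
    using lborel.nn_integral_fst[OF meas] by (simp add: mean_sq_def case_prod_unfold)
  also have "\<dots> = (\<integral>\<^sup>+\<omega>. ennreal (\<Sum>i\<in>S. \<Sum>j\<in>S. \<xi> i \<omega> * \<xi> j \<omega> * ov i j) \<partial>M)"
    using R by (intro nn_integral_cong) (simp add: nn_integral_eq_integral has_bochner_integral_iff)
  also have "\<dots> = ennreal V"
    using R2 Rnonneg by (simp add: nn_integral_eq_integral has_bochner_integral_iff)
  also have "\<dots> = mean_sq M (\<lambda>\<omega>. \<Sum>i\<in>S. \<xi> i \<omega> * (B (b i) \<omega> - B (a i) \<omega>))"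
    using L unfolding mean_sq_def by (simp add: nn_integral_eq_integral has_bochner_integral_iff)
  finally show ?thesis by simp
qed

section \<open>Elementary integrals restricted to a time interval\<close>

lemma simple_processD:
  assumes "simple_process F n \<tau> \<xi>" "i < n"
  shows "0 \<le> \<tau> i" "\<tau> i \<le> \<tau> (Suc i)" "\<tau> (Suc i) \<le> 1" "\<xi> i \<in> borel_measurable (F (\<tau> i))"
    "\<xi> i \<in> borel_measurable M" "\<exists>C. \<forall>\<omega>\<in>space M. \<bar>\<xi> i \<omega>\<bar> \<le> C"
proof -
  have 1: "\<tau> i \<in> {0..1}" "\<tau> (Suc i) \<in> {0..1}" using assms unfolding simple_process_def by auto
  then show "0 \<le> \<tau> i" "\<tau> (Suc i) \<le> 1" by auto
  show "\<tau> i \<le> \<tau> (Suc i)" and 2: "\<xi> i \<in> borel_measurable (F (\<tau> i))"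
    using assms unfolding simple_process_def by auto
  show "\<xi> i \<in> borel_measurable M" using measurable_F[OF 1(1) 2] .
  have "space (F (\<tau> i)) = space M" using subalgebra_F[OF 1(1)] by (simp add: subalgebra_def)
  then show "\<exists>C. \<forall>\<omega>\<in>space M. \<bar>\<xi> i \<omega>\<bar> \<le> C"
    using assms unfolding simple_process_def by metis
qed

lemma clip_measurable:
  assumes "simple_process F n \<tau> \<xi>" "i < n" "0 \<le> s" "s \<le> t" "t \<le> 1"
    and "clip s t (\<tau> i) < clip s t (\<tau> (Suc i))"
  shows "\<xi> i \<in> borel_measurable (F (clip s t (\<tau> i)))"
proof -
  note D = simple_processD[OF assms(1,2)]
  show ?thesis
    by (rule measurable_F_mono[OF D(1) _ _ D(4)]) (use assms D(1-3) in \<open>auto simp: clip_def\<close>)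
qed

lemma simple_process_integral_increment:
  assumes "s \<le> t"
  shows "simple_process_integral B n \<tau> \<xi> t \<omega> - simple_process_integral B n \<tau> \<xi> s \<omega> =
    (\<Sum>i<n. \<xi> i \<omega> * (B (clip s t (\<tau> (Suc i))) \<omega> - B (clip s t (\<tau> i)) \<omega>))"
proof -
  have "B (min u t) \<omega> - B (min u s) \<omega> = B (clip s t u) \<omega> - B s \<omega>" for u
    using assms by (cases "u \<le> s") (auto simp: clip_def)
  then have "(B (min v t) \<omega> - B (min u t) \<omega>) - (B (min v s) \<omega> - B (min u s) \<omega>) = B (clip s t v) \<omega> - B (clip s t u) \<omega>" for u v
    by (smt (verit))
  then show ?thesis
    unfolding simple_process_integral_def sum_subtractf[symmetric] right_diff_distrib[symmetric] by simp
qed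

lemma simple_process_value_clip:
  assumes "s \<le> t"
  shows "indicator {s<..t} r * simple_process_value n \<tau> \<xi> r \<omega> =
    (\<Sum>i<n. \<xi> i \<omega> * indicator {clip s t (\<tau> i)<..clip s t (\<tau> (Suc i))} r)"
proof -
  have "indicator {s<..t} r * indicator {u<..v} r = (indicator {clip s t u<..clip s t v} r :: real)" for u v
    using assms by (auto simp: indicator_def clip_def)
  then show ?thesis
    unfolding simple_process_value_def sum_distrib_left by (simp add: mult.left_commute)
qed

text \<open>Two processes appear because approximating sequences belonging to different times have
  to be compared. An empty second process gives the usual isometry.\<close>

lemma simple_process_isometry:
  assumes P: "simple_process F n \<tau> \<xi>" and P': "simple_process F n' \<tau>' \<xi>'"
    and st: "0 \<le> s" "s \<le> t" "t \<le> 1"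
  shows "mean_sq M (\<lambda>\<omega>. (simple_process_integral B n \<tau> \<xi> t \<omega> - simple_process_integral B n \<tau> \<xi> s \<omega>)
      - (simple_process_integral B n' \<tau>' \<xi>' t \<omega> - simple_process_integral B n' \<tau>' \<xi>' s \<omega>)) =
    mean_sq (M \<Otimes>\<^sub>M lborel) (\<lambda>(\<omega>, r). indicator {s<..t} r *
      (simple_process_value n \<tau> \<xi> r \<omega> - simple_process_value n' \<tau>' \<xi>' r \<omega>))"
proof -
  \<comment> \<open>The disjoint sum of the index sets merges two unrelated grids into one family;
    the coefficients of the second are negated.\<close>
  define S where "S = {..<n} <+> {..<n'}"
  define a where "a = case_sum (\<lambda>i. clip s t (\<tau> i)) (\<lambda>i. clip s t (\<tau>' i))"
  define b where "b = case_sum (\<lambda>i. clip s t (\<tau> (Suc i))) (\<lambda>i. clip s t (\<tau>' (Suc i)))"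
  define \<zeta> where "\<zeta> = case_sum \<xi> (\<lambda>i \<omega>. - \<xi>' i \<omega>)"
  have "mean_sq M (\<lambda>\<omega>. \<Sum>i\<in>S. \<zeta> i \<omega> * (B (b i) \<omega> - B (a i) \<omega>)) =
    mean_sq (M \<Otimes>\<^sub>M lborel) (\<lambda>(\<omega>, r). \<Sum>i\<in>S. \<zeta> i \<omega> * indicator {a i<..b i} r)"
  proof (rule elementary_isometry)
    show "finite S" by (simp add: S_def)
    fix i assume "i \<in> S"
    then consider j where "i = Inl j" "j < n" | j where "i = Inr j" "j < n'" by (auto simp: S_def)
    then have "(0 \<le> a i \<and> a i \<le> b i \<and> b i \<le> 1) \<and> (a i < b i \<longrightarrow> \<zeta> i \<in> borel_measurable (F (a i)))
      \<and> \<zeta> i \<in> borel_measurable M \<and> (\<exists>C. \<forall>\<omega>\<in>space M. \<bar>\<zeta> i \<omega>\<bar> \<le> C)"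
    proof cases
      case 1
      note D = simple_processD[OF P 1(2)]
      show ?thesis using 1 D st clip_measurable[OF P 1(2) st]
        by (auto simp: a_def b_def \<zeta>_def clip_def)
    next
      case 2
      note D = simple_processD[OF P' 2(2)]
      show ?thesis using 2 D st clip_measurable[OF P' 2(2) st]
        by (auto simp: a_def b_def \<zeta>_def clip_def)
    qed
    then show "0 \<le> a i \<and> a i \<le> b i \<and> b i \<le> 1" "a i < b i \<Longrightarrow> \<zeta> i \<in> borel_measurable (F (a i))"
      "\<zeta> i \<in> borel_measurable M" "\<exists>C. \<forall>\<omega>\<in>space M. \<bar>\<zeta> i \<omega>\<bar> \<le> C" by auto
  qed
  moreover have eq: "(\<Sum>i\<in>S. \<zeta> i \<omega> * f (b i) (a i)) =
      (\<Sum>i<n. \<xi> i \<omega> * f (clip s t (\<tau> (Suc i))) (clip s t (\<tau> i))) -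
      (\<Sum>i<n'. \<xi>' i \<omega> * f (clip s t (\<tau>' (Suc i))) (clip s t (\<tau>' i)))" for \<omega> and f :: "real \<Rightarrow> real \<Rightarrow> real"
    by (simp add: S_def a_def b_def \<zeta>_def sum.Plus sum_negf)
  ultimately show ?thesis
    unfolding right_diff_distrib[of "indicator _ _"] simple_process_integral_increment[OF st(2)] simple_process_value_clip[OF st(2)]
      eq[of _ "\<lambda>v u. B v _ - B u _"] eq[of _ "\<lambda>v u. indicator {u<..v} _"] by simp
qed

text \<open>The martingale property, tested against variables known at time s in place of a
  conditional expectation. On each nondegenerate clipped interval the weight Y \<xi>, with \<xi> the
  coefficient there, is known at the left end, so \<open>increment_product\<close> makes every term
  0.\<close>

lemma simple_process_orthogonal:
  assumes P: "simple_process F n \<tau> \<xi>" and st: "0 \<le> s" "s \<le> t" "t \<le> 1"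
    and Y: "Y \<in> borel_measurable (F s)" "integrable M Y"
  shows "has_bochner_integral M (\<lambda>\<omega>. Y \<omega> * (simple_process_integral B n \<tau> \<xi> t \<omega> - simple_process_integral B n \<tau> \<xi> s \<omega>)) 0"
proof -
  have "has_bochner_integral M (\<lambda>\<omega>. \<Sum>i<n. (Y \<omega> * \<xi> i \<omega>) * (B (clip s t (\<tau> (Suc i))) \<omega> - B (clip s t (\<tau> i)) \<omega>)) (\<Sum>i<n. 0)"
  proof (rule has_bochner_integral_sum)
    fix i assume "i \<in> {..<n}"
    then have i: "i < n" by simp
    note D = simple_processD[OF P i]
    obtain C where C: "\<And>\<omega>. \<omega> \<in> space M \<Longrightarrow> \<bar>\<xi> i \<omega>\<bar> \<le> C" using D(6) by auto
    show "has_bochner_integral M (\<lambda>\<omega>. (Y \<omega> * \<xi> i \<omega>) * (B (clip s t (\<tau> (Suc i))) \<omega> - B (clip s t (\<tau> i)) \<omega>)) 0"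
    proof (cases "clip s t (\<tau> i) < clip s t (\<tau> (Suc i))")
      case True
      have le: "s \<le> clip s t (\<tau> i)" "clip s t (\<tau> (Suc i)) \<le> 1" using D st by (auto simp: clip_def)
      show ?thesis
      proof (rule increment_product(1))
        show "(\<lambda>\<omega>. Y \<omega> * \<xi> i \<omega>) \<in> borel_measurable (F (clip s t (\<tau> i)))"
          using clip_measurable[OF P i st True] measurable_F_mono[OF st(1) le(1) _ Y(1)] le True
          by (intro borel_measurable_times) auto
        show "integrable M (\<lambda>\<omega>. Y \<omega> * \<xi> i \<omega>)"
        proof (rule Bochner_Integration.integrable_bound[OF integrable_mult_left[OF Y(2), of C]])
          show "(\<lambda>\<omega>. Y \<omega> * \<xi> i \<omega>) \<in> borel_measurable M" using Y(2) D(5) by auto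
          have "\<bar>Y \<omega>\<bar> * \<bar>\<xi> i \<omega>\<bar> \<le> \<bar>Y \<omega>\<bar> * \<bar>C\<bar>" if "\<omega> \<in> space M" for \<omega>
            using C[OF that] by (intro mult_left_mono) auto
          then show "AE \<omega> in M. norm (Y \<omega> * \<xi> i \<omega>) \<le> norm (Y \<omega> * C)" by (simp add: abs_mult)
        qed
      qed (use le True st in auto)
    next
      case False
      then have "clip s t (\<tau> i) = clip s t (\<tau> (Suc i))" using D by (auto simp: clip_def)
      then show ?thesis by (simp add: has_bochner_integral_zero)
    qed
  qed
  then show ?thesis
    unfolding simple_process_integral_increment[OF st(2)] by (simp add: sum_distrib_left mult.assoc)
qed

end

section \<open>Ito integrals of deterministic functions\<close>

lemma tendsto_0_ennreal_le:
  fixes f a b :: "nat \<Rightarrow> ennreal"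
  assumes "a \<longlonglongrightarrow> 0" "b \<longlonglongrightarrow> 0" "\<And>k. f k \<le> 2 * a k + 2 * b k"
  shows "f \<longlonglongrightarrow> 0"
proof (rule tendsto_sandwich[OF _ _ tendsto_const])
  have "(\<lambda>k. 2 * a k + 2 * b k) \<longlonglongrightarrow> 2 * 0 + 2 * 0"
    by (intro tendsto_add ennreal_tendsto_cmult assms) auto
  then show "(\<lambda>k. 2 * a k + 2 * b k) \<longlonglongrightarrow> 0" by simp
qed (use assms(3) in auto)

lemma (in prob_space) mean_sq_pair_const:
  assumes [measurable]: "f \<in> borel_measurable borel"
  shows "mean_sq (M \<Otimes>\<^sub>M lborel) (\<lambda>(\<omega>, r). f r) = mean_sq lborel f"
proof -
  have "(\<lambda>(\<omega>, r). ennreal ((f r)\<^sup>2)) \<in> borel_measurable (M \<Otimes>\<^sub>M lborel)" by measurable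
  from lborel.nn_integral_fst[OF this] show ?thesis
    by (simp add: mean_sq_def case_prod_unfold emeasure_space_1)
qed

context brownian_motion
begin

lemma simple_process_value_measurable:
  assumes "simple_process F n \<tau> \<xi>"
  shows "(\<lambda>(\<omega>, r). simple_process_value n \<tau> \<xi> r \<omega>) \<in> borel_measurable (M \<Otimes>\<^sub>M lborel)"
proof -
  have [measurable]: "i \<in> {..<n} \<Longrightarrow> \<xi> i \<in> borel_measurable M" for i
    using simple_processD(5)[OF assms] by auto
  show ?thesis unfolding simple_process_value_def by measurable
qed

lemma simple_process_integral_measurable:
  assumes "simple_process F n \<tau> \<xi>" "t \<in> {0..1}"
  shows "simple_process_integral B n \<tau> \<xi> t \<in> borel_measurable M"
proof -
  have "(\<lambda>\<omega>. \<Sum>i<n. \<xi> i \<omega> * (B (min (\<tau> (Suc i)) t) \<omega> - B (min (\<tau> i) t) \<omega>)) \<in> borel_measurable M"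
  proof (intro borel_measurable_sum borel_measurable_times borel_measurable_diff measurable_B)
    fix i assume "i \<in> {..<n}"
    then have i: "i < n" by simp
    note D = simple_processD[OF assms(1) i]
    show "\<xi> i \<in> borel_measurable M" "min (\<tau> (Suc i)) t \<in> {0..1}" "min (\<tau> i) t \<in> {0..1}"
      using D assms(2) by auto
  qed
  then show ?thesis by (simp add: simple_process_integral_def[abs_def])
qed

lemma simple_process_integral_0:
  assumes "simple_process F n \<tau> \<xi>"
  shows "simple_process_integral B n \<tau> \<xi> 0 \<omega> = 0"
  unfolding simple_process_integral_def
proof (intro sum.neutral ballI)
  fix i assume "i \<in> {..<n}"
  then have "i < n" by simp
  note D = simple_processD[OF assms this]
  show "\<xi> i \<omega> * (B (min (\<tau> (Suc i)) 0) \<omega> - B (min (\<tau> i) 0) \<omega>) = 0"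
    using D by (simp add: min_absorb2)
qed

lemma ito_integral_measurable:
  assumes "ito_integral M F B H I" "t \<in> {0..<1}"
  shows "I t \<in> borel_measurable (F t)" "I t \<in> borel_measurable M"
proof -
  show "I t \<in> borel_measurable (F t)" using assms by (simp add: ito_integral_def)
  then show "I t \<in> borel_measurable M" using assms(2) by (intro measurable_F[of t]) auto
qed

text \<open>
  As \<open>\<sigma>\<close> is arbitrary outside \<open>[0, 1)\<close>, a Borel function \<open>g\<close> replaces it.
\<close>

lemma ito_approximation_at:
  assumes I: "ito_integral M F B (\<lambda>t \<omega>. \<sigma> t) I"
    and g: "g \<in> borel_measurable borel" "\<forall>r\<in>{0..<1}. g r = \<sigma> r" and T: "T \<in> {0..<1}"
  obtains n \<tau> \<xi> where "\<And>k. simple_process F (n k) (\<tau> k) (\<xi> k)"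
    "(\<lambda>k. mean_sq (M \<Otimes>\<^sub>M lborel) (\<lambda>(\<omega>, r). indicator {0..T} r *
       (g r - simple_process_value (n k) (\<tau> k) (\<xi> k) r \<omega>))) \<longlonglongrightarrow> 0"
    "(\<lambda>k. mean_sq M (\<lambda>\<omega>. I T \<omega> - simple_process_integral B (n k) (\<tau> k) (\<xi> k) T \<omega>)) \<longlonglongrightarrow> 0"
proof -
  obtain n \<tau> \<xi> where P: "\<And>k::nat. simple_process F (n k) (\<tau> k) (\<xi> k)"
    and 1: "(\<lambda>k. \<integral>\<^sup>+\<omega>. (\<integral>\<^sup>+s\<in>{0..T}. ennreal ((\<sigma> s - simple_process_value (n k) (\<tau> k) (\<xi> k) s \<omega>)\<^sup>2) \<partial>lborel) \<partial>M)
          \<longlonglongrightarrow> 0"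
    and 2: "(\<lambda>k. \<integral>\<^sup>+\<omega>. ennreal ((I T \<omega> - simple_process_integral B (n k) (\<tau> k) (\<xi> k) T \<omega>)\<^sup>2) \<partial>M)
          \<longlonglongrightarrow> 0"
    using I T unfolding ito_integral_def by blast
  have "(\<integral>\<^sup>+\<omega>. (\<integral>\<^sup>+s\<in>{0..T}. ennreal ((\<sigma> s - simple_process_value (n k) (\<tau> k) (\<xi> k) s \<omega>)\<^sup>2) \<partial>lborel) \<partial>M)
     = mean_sq (M \<Otimes>\<^sub>M lborel) (\<lambda>(\<omega>, r). indicator {0..T} r *
       (g r - simple_process_value (n k) (\<tau> k) (\<xi> k) r \<omega>))" for k
  proof -
    note [measurable] = simple_process_value_measurable[OF P[of k]] g(1)
    have "(\<lambda>(\<omega>, r). ennreal ((indicator {0..T} r * (g r - simple_process_value (n k) (\<tau> k) (\<xi> k) r \<omega>))\<^sup>2))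
        \<in> borel_measurable (M \<Otimes>\<^sub>M lborel)" by measurable
    from lborel.nn_integral_fst[OF this]
    have "mean_sq (M \<Otimes>\<^sub>M lborel) (\<lambda>(\<omega>, r). indicator {0..T} r *
       (g r - simple_process_value (n k) (\<tau> k) (\<xi> k) r \<omega>)) =
      (\<integral>\<^sup>+\<omega>. (\<integral>\<^sup>+r. ennreal ((indicator {0..T} r * (g r - simple_process_value (n k) (\<tau> k) (\<xi> k) r \<omega>))\<^sup>2) \<partial>lborel) \<partial>M)"
      by (simp add: mean_sq_def case_prod_unfold)
    also have "\<dots> = (\<integral>\<^sup>+\<omega>. (\<integral>\<^sup>+s\<in>{0..T}. ennreal ((\<sigma> s - simple_process_value (n k) (\<tau> k) (\<xi> k) s \<omega>)\<^sup>2) \<partial>lborel) \<partial>M)"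
      using T g(2) by (intro nn_integral_cong) (auto simp: indicator_def)
    finally show ?thesis by simp
  qed
  with 1 have 3: "(\<lambda>k. mean_sq (M \<Otimes>\<^sub>M lborel) (\<lambda>(\<omega>, r). indicator {0..T} r *
       (g r - simple_process_value (n k) (\<tau> k) (\<xi> k) r \<omega>))) \<longlonglongrightarrow> 0" by simp
  show thesis by (rule that[OF P 3]) (use 2 in \<open>simp add: mean_sq_def\<close>)
qed

text \<open>
  The sequence in the definition of the integral depends on the time \<open>T\<close>; the isometry shows that the one
  for \<open>T\<close> also serves at every earlier time.
\<close>

lemma ito_approximation:
  assumes I: "ito_integral M F B (\<lambda>t \<omega>. \<sigma> t) I"
    and g: "g \<in> borel_measurable borel" "\<forall>r\<in>{0..<1}. g r = \<sigma> r" and T: "T \<in> {0..<1}"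
  obtains n \<tau> \<xi> where "\<And>k. simple_process F (n k) (\<tau> k) (\<xi> k)"
    "(\<lambda>k. mean_sq (M \<Otimes>\<^sub>M lborel) (\<lambda>(\<omega>, r). indicator {0..T} r *
       (g r - simple_process_value (n k) (\<tau> k) (\<xi> k) r \<omega>))) \<longlonglongrightarrow> 0"
    "\<And>s. s \<in> {0..T} \<Longrightarrow>
      (\<lambda>k. mean_sq M (\<lambda>\<omega>. I s \<omega> - simple_process_integral B (n k) (\<tau> k) (\<xi> k) s \<omega>)) \<longlonglongrightarrow> 0"
proof -
  obtain n \<tau> \<xi> where P: "\<And>k. simple_process F (n k) (\<tau> k) (\<xi> k)"
    and V: "(\<lambda>k. mean_sq (M \<Otimes>\<^sub>M lborel) (\<lambda>(\<omega>, r). indicator {0..T} r *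
       (g r - simple_process_value (n k) (\<tau> k) (\<xi> k) r \<omega>))) \<longlonglongrightarrow> 0"
    and "(\<lambda>k. mean_sq M (\<lambda>\<omega>. I T \<omega> - simple_process_integral B (n k) (\<tau> k) (\<xi> k) T \<omega>)) \<longlonglongrightarrow> 0"
    using ito_approximation_at[OF assms] by blast
  show thesis
  proof (rule that[OF P V])
    fix s assume s: "s \<in> {0..T}"
    then have s01: "s \<in> {0..<1}" "0 \<le> s" "s \<le> 1" "s \<in> {0..1}" using T by auto
    obtain n' \<tau>' \<xi>' where P': "\<And>k. simple_process F (n' k) (\<tau>' k) (\<xi>' k)"
      and V': "(\<lambda>k. mean_sq (M \<Otimes>\<^sub>M lborel) (\<lambda>(\<omega>, r). indicator {0..s} r *
         (g r - simple_process_value (n' k) (\<tau>' k) (\<xi>' k) r \<omega>))) \<longlonglongrightarrow> 0"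
      and J': "(\<lambda>k. mean_sq M (\<lambda>\<omega>. I s \<omega> - simple_process_integral B (n' k) (\<tau>' k) (\<xi>' k) s \<omega>)) \<longlonglongrightarrow> 0"
      using ito_approximation_at[OF I g s01(1)] by blast
    let ?J = "\<lambda>k. simple_process_integral B (n k) (\<tau> k) (\<xi> k) s"
    let ?J' = "\<lambda>k. simple_process_integral B (n' k) (\<tau>' k) (\<xi>' k) s"
    let ?V = "\<lambda>k r \<omega>. simple_process_value (n k) (\<tau> k) (\<xi> k) r \<omega>"
    let ?V' = "\<lambda>k r \<omega>. simple_process_value (n' k) (\<tau>' k) (\<xi>' k) r \<omega>"
    note IM = ito_integral_measurable(2)[OF I s01(1)]
    have JJ: "(\<lambda>k. mean_sq M (\<lambda>\<omega>. ?J' k \<omega> - ?J k \<omega>)) \<longlonglongrightarrow> 0"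
    proof (rule tendsto_0_ennreal_le[OF V V'])
      fix k
      note [measurable] = simple_process_value_measurable[OF P[of k]] simple_process_value_measurable[OF P'[of k]] g(1)
      have "mean_sq M (\<lambda>\<omega>. ?J' k \<omega> - ?J k \<omega>) =
          mean_sq (M \<Otimes>\<^sub>M lborel) (\<lambda>(\<omega>, r). indicator {0<..s} r * (?V' k r \<omega> - ?V k r \<omega>))"
        using simple_process_isometry[OF P'[of k] P[of k] order_refl s01(2,3)]
        by (simp add: simple_process_integral_0[OF P] simple_process_integral_0[OF P'])
      \<comment> \<open>Inserts g: on (0, s] it cancels from the two terms, each of which is then an
        approximation error tending to 0.\<close>
      also have "\<dots> \<le> mean_sq (M \<Otimes>\<^sub>M lborel) (\<lambda>x. indicator {0..T} (snd x) * (g (snd x) - ?V k (snd x) (fst x))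
          - indicator {0..s} (snd x) * (g (snd x) - ?V' k (snd x) (fst x)))"
        using s by (intro mean_sq_mono) (auto simp: indicator_def split: if_splits)
      also have "\<dots> \<le> 2 * mean_sq (M \<Otimes>\<^sub>M lborel) (\<lambda>x. indicator {0..T} (snd x) * (g (snd x) - ?V k (snd x) (fst x)))
          + 2 * mean_sq (M \<Otimes>\<^sub>M lborel) (\<lambda>x. indicator {0..s} (snd x) * (g (snd x) - ?V' k (snd x) (fst x)))"
        by (rule mean_sq_diff) measurable
      finally show "mean_sq M (\<lambda>\<omega>. ?J' k \<omega> - ?J k \<omega>) \<le>
          2 * mean_sq (M \<Otimes>\<^sub>M lborel) (\<lambda>(\<omega>, r). indicator {0..T} r * (g r - ?V k r \<omega>))
          + 2 * mean_sq (M \<Otimes>\<^sub>M lborel) (\<lambda>(\<omega>, r). indicator {0..s} r * (g r - ?V' k r \<omega>))"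
        by (simp add: case_prod_unfold)
    qed
    show "(\<lambda>k. mean_sq M (\<lambda>\<omega>. I s \<omega> - ?J k \<omega>)) \<longlonglongrightarrow> 0"
    proof (rule tendsto_0_ennreal_le[OF J' JJ])
      fix k
      note [measurable] = IM simple_process_integral_measurable[OF P s01(4), of k] simple_process_integral_measurable[OF P' s01(4), of k]
      show "mean_sq M (\<lambda>\<omega>. I s \<omega> - ?J k \<omega>) \<le> 2 * mean_sq M (\<lambda>\<omega>. I s \<omega> - ?J' k \<omega>) + 2 * mean_sq M (\<lambda>\<omega>. ?J' k \<omega> - ?J k \<omega>)"
        using mean_sq_add[of "\<lambda>\<omega>. I s \<omega> - ?J' k \<omega>" M "\<lambda>\<omega>. ?J' k \<omega> - ?J k \<omega>"] by simp
    qed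
  qed
qed

text \<open>Both parts are limits of facts on elementary integrals. The factor 4 is the price of
  using (a + b)^2 \<le> 2 a^2 + 2 b^2 twice: from I to its approximation, and from the simple
  process to g. The second part is the martingale property of I against square integrable Y.\<close>

lemma ito_increment_mean_sq:
  assumes I: "ito_integral M F B (\<lambda>t \<omega>. \<sigma> t) I"
    and g: "g \<in> borel_measurable borel" "\<forall>r\<in>{0..<1}. g r = \<sigma> r"
    and st: "0 \<le> s" "s \<le> t" "t < 1"
  shows "mean_sq M (\<lambda>\<omega>. I t \<omega> - I s \<omega>) \<le> 4 * mean_sq lborel (\<lambda>r. indicator {s<..t} r * g r)"
    and "\<And>Y. Y \<in> borel_measurable (F s) \<Longrightarrow> mean_sq M Y < \<infinity> \<Longrightarrow> (\<integral>\<omega>. Y \<omega> * (I t \<omega> - I s \<omega>) \<partial>M) = 0"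
proof -
  have T: "t \<in> {0..<1}" and s01: "s \<in> {0..<1}" "s \<in> {0..1}" "t \<in> {0..1}" "t \<le> 1" using st by auto
  obtain n \<tau> \<xi> where P: "\<And>k. simple_process F (n k) (\<tau> k) (\<xi> k)"
    and V: "(\<lambda>k. mean_sq (M \<Otimes>\<^sub>M lborel) (\<lambda>(\<omega>, r). indicator {0..t} r *
       (g r - simple_process_value (n k) (\<tau> k) (\<xi> k) r \<omega>))) \<longlonglongrightarrow> 0"
    and J: "\<And>s. s \<in> {0..t} \<Longrightarrow>
      (\<lambda>k. mean_sq M (\<lambda>\<omega>. I s \<omega> - simple_process_integral B (n k) (\<tau> k) (\<xi> k) s \<omega>)) \<longlonglongrightarrow> 0"
    using ito_approximation[OF I g T] by blast
  let ?J = "\<lambda>k t. simple_process_integral B (n k) (\<tau> k) (\<xi> k) t"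
  let ?V = "\<lambda>k r \<omega>. simple_process_value (n k) (\<tau> k) (\<xi> k) r \<omega>"
  define \<Delta> where "\<Delta> = (\<lambda>k \<omega>. (I t \<omega> - ?J k t \<omega>) - (I s \<omega> - ?J k s \<omega>))"
  note [measurable] = ito_integral_measurable(2)[OF I T] ito_integral_measurable(2)[OF I s01(1)]
    simple_process_integral_measurable[OF P s01(2)] simple_process_integral_measurable[OF P s01(3)]
    simple_process_value_measurable[OF P] g(1)
  have \<Delta>M[measurable]: "\<Delta> k \<in> borel_measurable M" for k unfolding \<Delta>_def by measurable
  have \<Delta>: "(\<lambda>k. mean_sq M (\<Delta> k)) \<longlonglongrightarrow> 0"
    by (rule tendsto_0_ennreal_le[OF J[of t] J[of s]])
       (use st in \<open>auto simp: \<Delta>_def intro!: mean_sq_diff\<close>)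
  define w where "w = mean_sq lborel (\<lambda>r. indicator {s<..t} r * g r)"
  define v where "v = (\<lambda>k. mean_sq (M \<Otimes>\<^sub>M lborel) (\<lambda>(\<omega>, r). indicator {0..t} r * (g r - ?V k r \<omega>)))"
  have bound: "mean_sq M (\<lambda>\<omega>. I t \<omega> - I s \<omega>) \<le> 2 * mean_sq M (\<Delta> k) + 2 * (2 * w + 2 * v k)" for k
  proof -
    \<comment> \<open>The isometry with an empty simple process, n' = 0, in second place.\<close>
    have "mean_sq M (\<lambda>\<omega>. ?J k t \<omega> - ?J k s \<omega>) =
        mean_sq (M \<Otimes>\<^sub>M lborel) (\<lambda>(\<omega>, r). indicator {s<..t} r * ?V k r \<omega>)"
      using simple_process_isometry[OF P[of k] _ st(1,2) s01(4), of 0 "\<lambda>_. 0" "\<lambda>_ _. 0"]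
      by (simp add: simple_process_def simple_process_integral_def[of B 0] simple_process_value_def[of 0])
    also have "\<dots> \<le> mean_sq (M \<Otimes>\<^sub>M lborel) (\<lambda>x. indicator {s<..t} (snd x) * g (snd x)
        - indicator {0..t} (snd x) * (g (snd x) - ?V k (snd x) (fst x)))"
      using st by (intro mean_sq_mono) (auto simp: indicator_def split: if_splits)
    also have "\<dots> \<le> 2 * mean_sq (M \<Otimes>\<^sub>M lborel) (\<lambda>x. indicator {s<..t} (snd x) * g (snd x)) +
        2 * mean_sq (M \<Otimes>\<^sub>M lborel) (\<lambda>x. indicator {0..t} (snd x) * (g (snd x) - ?V k (snd x) (fst x)))"
      by (rule mean_sq_diff) measurable
    also have "\<dots> = 2 * w + 2 * v k"
      using mean_sq_pair_const[of "\<lambda>r. indicator {s<..t} r * g r"] by (simp add: w_def v_def case_prod_unfold)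
    finally have 1: "mean_sq M (\<lambda>\<omega>. ?J k t \<omega> - ?J k s \<omega>) \<le> 2 * w + 2 * v k" .
    have "mean_sq M (\<lambda>\<omega>. I t \<omega> - I s \<omega>) = mean_sq M (\<lambda>\<omega>. \<Delta> k \<omega> + (?J k t \<omega> - ?J k s \<omega>))"
      by (simp add: \<Delta>_def algebra_simps)
    also have "\<dots> \<le> 2 * mean_sq M (\<Delta> k) + 2 * mean_sq M (\<lambda>\<omega>. ?J k t \<omega> - ?J k s \<omega>)"
      by (rule mean_sq_add) measurable
    also have "\<dots> \<le> 2 * mean_sq M (\<Delta> k) + 2 * (2 * w + 2 * v k)"
      by (intro add_left_mono mult_left_mono 1) auto
    finally show ?thesis .
  qed
  have "(\<lambda>k. 2 * mean_sq M (\<Delta> k) + 2 * (2 * w + 2 * v k)) \<longlonglongrightarrow> 2 * 0 + 2 * (2 * w + 2 * 0)"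
    unfolding v_def by (intro tendsto_add ennreal_tendsto_cmult tendsto_const \<Delta> V) auto
  then have "mean_sq M (\<lambda>\<omega>. I t \<omega> - I s \<omega>) \<le> 2 * 0 + 2 * (2 * w + 2 * 0)"
    by (rule LIMSEQ_le_const) (use bound in blast)
  also have "\<dots> = (2 * 2) * w" by (simp only: mult_zero_right add_0 add_0_right mult.assoc)
  finally show "mean_sq M (\<lambda>\<omega>. I t \<omega> - I s \<omega>) \<le> 4 * mean_sq lborel (\<lambda>r. indicator {s<..t} r * g r)"
    by (simp add: w_def)
  fix Y assume Y: "Y \<in> borel_measurable (F s)" and Y2: "mean_sq M Y < \<infinity>"
  have YM[measurable]: "Y \<in> borel_measurable M" using measurable_F[OF s01(2) Y] .
  have "mean_sq M (\<lambda>_. 1) < \<infinity>" by (simp add: mean_sq_def emeasure_space_1)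
  from integrable_mult_mean_sq[OF YM _ Y2 this] have Yint: "integrable M Y" by simp
  \<comment> \<open>Convergence to 0 in \<open>ennreal\<close> allows finitely many infinite errors,
    so integrability of Y times the error is available only for large k.\<close>
  have "\<forall>\<^sub>F k in sequentially. mean_sq M (\<Delta> k) < \<infinity>" using \<Delta> by (rule order_tendstoD) simp
  then have ev: "\<forall>\<^sub>F k in sequentially. ennreal ((\<integral>\<omega>. Y \<omega> * (I t \<omega> - I s \<omega>) \<partial>M)\<^sup>2) \<le> mean_sq M Y * mean_sq M (\<Delta> k)"
  proof eventually_elim
    case (elim k)
    have a: "integrable M (\<lambda>\<omega>. Y \<omega> * \<Delta> k \<omega>)" by (rule integrable_mult_mean_sq) (use Y2 elim in auto)
    have b: "has_bochner_integral M (\<lambda>\<omega>. Y \<omega> * (?J k t \<omega> - ?J k s \<omega>)) 0"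
      by (rule simple_process_orthogonal[OF P st(1,2) s01(4) Y Yint])
    have "(\<lambda>\<omega>. Y \<omega> * (I t \<omega> - I s \<omega>)) = (\<lambda>\<omega>. Y \<omega> * \<Delta> k \<omega> + Y \<omega> * (?J k t \<omega> - ?J k s \<omega>))"
      by (simp add: \<Delta>_def algebra_simps)
    then have "(\<integral>\<omega>. Y \<omega> * (I t \<omega> - I s \<omega>) \<partial>M) = (\<integral>\<omega>. Y \<omega> * \<Delta> k \<omega> \<partial>M)"
      using a b by (simp add: has_bochner_integral_iff)
    then show ?case using integral_square_le_mean_sq[of Y M "\<Delta> k"] by simp
  qed
  have "(\<lambda>k. mean_sq M Y * mean_sq M (\<Delta> k)) \<longlonglongrightarrow> mean_sq M Y * 0"
    using Y2 by (intro ennreal_tendsto_cmult \<Delta>) simp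
  from tendsto_lowerbound[OF this ev] have "ennreal ((\<integral>\<omega>. Y \<omega> * (I t \<omega> - I s \<omega>) \<partial>M)\<^sup>2) \<le> 0" by simp
  then show "(\<integral>\<omega>. Y \<omega> * (I t \<omega> - I s \<omega>) \<partial>M) = 0" by simp
qed

end

section \<open>Almost sure convergence\<close>

text \<open>A Cauchy criterion relative to one base point s, the form in which a maximal inequality
  controls a path. Two comparisons with f s lie within e / 2 of each other once each is at most e /
  4, and one more quarter reaches the limit.\<close>

lemma at_left_convergent_of_cauchy:
  fixes f :: "real \<Rightarrow> real"
  assumes "\<And>e. 0 < e \<Longrightarrow> \<exists>s<a. \<forall>t\<in>{s..<a}. \<bar>f t - f s\<bar> \<le> e"
  shows "\<exists>c. (f \<longlongrightarrow> c) (at_left a)"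
proof -
  define x where "x = (\<lambda>n::nat. f (a - inverse (real (Suc n))))"
  have lt: "a - inverse (real (Suc n)) < a" for n by simp
  have ev: "\<forall>\<^sub>F n in sequentially. s \<le> a - inverse (real (Suc n))" if "s < a" for s
  proof -
    have "(\<lambda>n. a - inverse (real (Suc n))) \<longlonglongrightarrow> a"
      using LIMSEQ_inverse_real_of_nat_add_minus[of a] by simp
    from order_tendstoD(1)[OF this that] show ?thesis by eventually_elim simp
  qed
  have "Cauchy x"
  proof (rule CauchyI)
    fix e :: real assume "0 < e"
    then obtain s where s: "s < a" "\<forall>t\<in>{s..<a}. \<bar>f t - f s\<bar> \<le> e / 4" using assms[of "e / 4"] by auto
    from ev[OF s(1)] obtain N where N: "\<And>n. N \<le> n \<Longrightarrow> s \<le> a - inverse (real (Suc n))"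
      by (auto simp: eventually_sequentially)
    show "\<exists>N. \<forall>m\<ge>N. \<forall>n\<ge>N. norm (x m - x n) < e"
    proof (intro exI allI impI)
      fix m n assume "N \<le> m" "N \<le> n"
      then have "\<bar>x m - f s\<bar> \<le> e / 4" "\<bar>x n - f s\<bar> \<le> e / 4"
        using N lt s(2) by (auto simp: x_def)
      then show "norm (x m - x n) < e" using \<open>0 < e\<close> unfolding real_norm_def by linarith
    qed
  qed
  then obtain c where c: "x \<longlonglongrightarrow> c" using Cauchy_convergent_iff convergent_def by blast
  have "(f \<longlongrightarrow> c) (at_left a)"
  proof (rule tendstoI)
    fix e :: real assume e: "0 < e"
    then obtain s where s: "s < a" "\<forall>t\<in>{s..<a}. \<bar>f t - f s\<bar> \<le> e / 4" using assms[of "e / 4"] by auto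
    have "\<forall>\<^sub>F n in sequentially. dist (x n) c < e / 4" using c e by (intro tendstoD) auto
    with ev[OF s(1)] have "\<forall>\<^sub>F n in sequentially. dist (x n) c < e / 4 \<and> s \<le> a - inverse (real (Suc n))"
      by eventually_elim simp
    then obtain n where n: "dist (x n) c < e / 4" "s \<le> a - inverse (real (Suc n))"
      using eventually_happens'[OF sequentially_bot] by blast
    have xn: "\<bar>x n - f s\<bar> \<le> e / 4" using s(2) n(2) lt by (auto simp: x_def)
    show "\<forall>\<^sub>F t in at_left a. dist (f t) c < e"
    proof (rule eventually_at_leftI[OF _ s(1)])
      fix t assume "t \<in> {s<..<a}"
      then have "\<bar>f t - f s\<bar> \<le> e / 4" using s(2) by auto
      then show "dist (f t) c < e" using xn n(1) e unfolding dist_real_def by linarith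
    qed
  qed
  then show ?thesis by blast
qed

lemma mean_sq_interval:
  fixes g :: "real \<Rightarrow> real"
  assumes "continuous_on {s..t} g"
  shows "mean_sq lborel (\<lambda>r. indicator {s..t} r * g r) = ennreal (integral {s..t} (\<lambda>r. (g r)\<^sup>2))"
proof -
  have c: "continuous_on {s..t} (\<lambda>r. (g r)\<^sup>2)" using assms by (intro continuous_intros)
  have i: "set_integrable lborel {s..t} (\<lambda>r. (g r)\<^sup>2)" by (rule borel_integrable_atLeastAtMost'[OF c])
  have "mean_sq lborel (\<lambda>r. indicator {s..t} r * g r) = (\<integral>\<^sup>+r. ennreal (indicator {s..t} r *\<^sub>R (g r)\<^sup>2) \<partial>lborel)"
    unfolding mean_sq_def by (intro nn_integral_cong) (simp add: indicator_def)
  also have "\<dots> = ennreal (set_lebesgue_integral lborel {s..t} (\<lambda>r. (g r)\<^sup>2))"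
    using i unfolding set_integrable_def set_lebesgue_integral_def by (intro nn_integral_eq_integral) auto
  also have "set_lebesgue_integral lborel {s..t} (\<lambda>r. (g r)\<^sup>2) = integral {s..t} (\<lambda>r. (g r)\<^sup>2)"
    by (rule set_borel_integral_eq_integral(2)[OF i])
  finally show ?thesis .
qed

section \<open>Maximal inequality and the endpoint limit of the Ito integral\<close>

context brownian_motion
begin

text \<open>Kolmogorov's argument. \<open>A u\<close> is the event that u is the first time in P at
  which |S| reaches l; these events are disjoint and \<open>A u\<close> is known at time u. On
  \<open>A u\<close>, (S T)^2 is expanded around S u.\<close>

lemma maximal_inequality:
  fixes S :: "real \<Rightarrow> 'a \<Rightarrow> real"
  assumes P: "finite P" "P \<subseteq> {0..1}" and l: "0 < l"
    and SF: "\<And>u. u \<in> P \<Longrightarrow> S u \<in> borel_measurable (F u)" and TM: "S T \<in> borel_measurable M"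
    and fin: "\<And>u. u \<in> P \<Longrightarrow> mean_sq M (S u) < \<infinity>" and finT: "mean_sq M (S T) < \<infinity>"
    and orth: "\<And>u Y. u \<in> P \<Longrightarrow> Y \<in> borel_measurable (F u) \<Longrightarrow> mean_sq M Y < \<infinity> \<Longrightarrow>
      (\<integral>\<omega>. Y \<omega> * (S T \<omega> - S u \<omega>) \<partial>M) = 0"
  shows "ennreal (l\<^sup>2 * prob {\<omega> \<in> space M. \<exists>u\<in>P. l \<le> \<bar>S u \<omega>\<bar>}) \<le> mean_sq M (S T)"
proof -
  define A where "A = (\<lambda>u. {\<omega> \<in> space M. l \<le> \<bar>S u \<omega>\<bar> \<and> (\<forall>v\<in>{v \<in> P. v < u}. \<bar>S v \<omega>\<bar> < l)})"
  have SM: "S u \<in> borel_measurable M" if "u \<in> P" for u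
    using measurable_F[OF _ SF[OF that]] that P(2) by auto
  have AF: "A u \<in> sets (F u)" if u: "u \<in> P" for u
  proof -
    have sp: "space (F u) = space M" using subalgebra_F[of u] u P(2) by (auto simp: subalgebra_def)
    have [measurable]: "S v \<in> borel_measurable (F u)" if "v \<in> {v \<in> P. v < u}" for v
      using that u P(2) by (intro measurable_F_mono[OF _ _ _ SF[of v], of u]) auto
    note [measurable] = SF[OF u]
    have [simp]: "finite {v \<in> P. v < u}" using P by simp
    show ?thesis unfolding A_def sp[symmetric] by measurable
  qed
  have AM[measurable]: "A u \<in> sets M" if "u \<in> P" for u
  proof -
    have "u \<in> {0..1}" using that P(2) by blast
    then show ?thesis using AF[OF that] subalgebra_F[of u] by (auto simp: subalgebra_def)
  qed
  have disj: "disjoint_family_on A P"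
    unfolding disjoint_family_on_def A_def by (fastforce simp: not_less_iff_gr_or_eq neq_iff)
  have Un: "(\<Union>u\<in>P. A u) = {\<omega> \<in> space M. \<exists>u\<in>P. l \<le> \<bar>S u \<omega>\<bar>}"
  proof (intro equalityI subsetI)
    fix \<omega> assume \<omega>: "\<omega> \<in> {\<omega> \<in> space M. \<exists>u\<in>P. l \<le> \<bar>S u \<omega>\<bar>}"
    define u where "u = Min {u \<in> P. l \<le> \<bar>S u \<omega>\<bar>}"
    have "u \<in> {u \<in> P. l \<le> \<bar>S u \<omega>\<bar>}" unfolding u_def using \<omega> P(1) by (intro Min_in) auto
    moreover have "\<bar>S v \<omega>\<bar> < l" if "v \<in> P" "v < u" for v
    proof (rule ccontr)
      assume "\<not> \<bar>S v \<omega>\<bar> < l"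
      then have "u \<le> v" unfolding u_def using that P(1) by (intro Min_le) auto
      with that show False by simp
    qed
    ultimately show "\<omega> \<in> (\<Union>u\<in>P. A u)" using \<omega> by (auto simp: A_def)
  qed (auto simp: A_def)
  have I2: "integrable M (\<lambda>\<omega>. (S T \<omega>)\<^sup>2)" by (rule mean_sq_finite_integrable[OF TM finT])
  have step: "l\<^sup>2 * prob (A u) \<le> (\<integral>\<omega>. indicator (A u) \<omega> * (S T \<omega>)\<^sup>2 \<partial>M)" if u: "u \<in> P" for u
  proof -
    note [measurable] = SM[OF u] TM AM[OF u]
    have Iu: "integrable M (\<lambda>\<omega>. (S u \<omega>)\<^sup>2)" by (rule mean_sq_finite_integrable[OF SM[OF u] fin[OF u]])
    have ind: "integrable M (\<lambda>\<omega>. indicator (A u) \<omega> * f \<omega>)" if "integrable M f" for f :: "'a \<Rightarrow> real"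
      using integrable_mult_indicator[OF AM[OF u] that] by simp
    define Y where "Y = (\<lambda>\<omega>. indicator (A u) \<omega> * S u \<omega>)"
    have YF: "Y \<in> borel_measurable (F u)" unfolding Y_def using AF[OF u] SF[OF u] by measurable
    have Yfin: "mean_sq M Y < \<infinity>"
      by (rule le_less_trans[OF mean_sq_mono fin[OF u]]) (simp add: Y_def indicator_def)
    have dfin: "mean_sq M (\<lambda>\<omega>. S T \<omega> - S u \<omega>) < \<infinity>"
      by (rule le_less_trans[OF mean_sq_diff[OF TM SM[OF u]]])
         (use fin[OF u] finT in \<open>simp add: ennreal_mult_less_top\<close>)
    have YM: "Y \<in> borel_measurable M" unfolding Y_def by measurable
    have i1: "integrable M (\<lambda>\<omega>. Y \<omega> * (S T \<omega> - S u \<omega>))"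
      by (rule integrable_mult_mean_sq[OF YM _ Yfin dfin]) measurable
    have i2: "integrable M (\<lambda>\<omega>. indicator (A u) \<omega> * (S T \<omega> - S u \<omega>)\<^sup>2)"
      by (rule ind[OF mean_sq_finite_integrable[OF _ dfin]]) measurable
    have "l\<^sup>2 * prob (A u) = (\<integral>\<omega>. indicator (A u) \<omega> * l\<^sup>2 \<partial>M)" by simp
    also have "\<dots> \<le> (\<integral>\<omega>. indicator (A u) \<omega> * (S u \<omega>)\<^sup>2 \<partial>M)"
    proof (rule integral_mono)
      show "integrable M (\<lambda>\<omega>. indicator (A u) \<omega> * l\<^sup>2)" by (rule ind) simp
      show "integrable M (\<lambda>\<omega>. indicator (A u) \<omega> * (S u \<omega>)\<^sup>2)" by (rule ind[OF Iu])
      fix \<omega> assume "\<omega> \<in> space M"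
      show "indicator (A u) \<omega> * l\<^sup>2 \<le> indicator (A u) \<omega> * (S u \<omega>)\<^sup>2"
        using l abs_le_square_iff[of l "S u \<omega>"] by (auto simp: indicator_def A_def)
    qed
    \<comment> \<open>The added cross term has mean 0 by \<open>orth\<close>, as Y is known at time
      u, and the added square is nonnegative. Together with the first term they complete (S T)^2 on
      \<open>A u\<close>.\<close>
    also have "\<dots> \<le> (\<integral>\<omega>. indicator (A u) \<omega> * (S u \<omega>)\<^sup>2 + 2 * (Y \<omega> * (S T \<omega> - S u \<omega>)) + indicator (A u) \<omega> * (S T \<omega> - S u \<omega>)\<^sup>2 \<partial>M)"
      using orth[OF u YF Yfin] i1 i2 ind[OF Iu] by simp
    also have "\<dots> = (\<integral>\<omega>. indicator (A u) \<omega> * (S T \<omega>)\<^sup>2 \<partial>M)"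
      by (intro Bochner_Integration.integral_cong) (auto simp: Y_def indicator_def power2_eq_square algebra_simps)
    finally show ?thesis .
  qed
  have "l\<^sup>2 * prob {\<omega> \<in> space M. \<exists>u\<in>P. l \<le> \<bar>S u \<omega>\<bar>} = (\<Sum>u\<in>P. l\<^sup>2 * prob (A u))"
    unfolding Un[symmetric] sum_distrib_left[symmetric]
    by (subst finite_measure_finite_Union[OF P(1) _ disj]) auto
  also have "\<dots> \<le> (\<Sum>u\<in>P. \<integral>\<omega>. indicator (A u) \<omega> * (S T \<omega>)\<^sup>2 \<partial>M)" by (rule sum_mono[OF step])
  also have "\<dots> = (\<integral>\<omega>. (\<Sum>u\<in>P. indicator (A u) \<omega> * (S T \<omega>)\<^sup>2) \<partial>M)"
  proof (rule Bochner_Integration.integral_sum[symmetric])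
    fix u assume "u \<in> P"
    from integrable_mult_indicator[OF AM[OF this] I2]
    show "integrable M (\<lambda>\<omega>. indicator (A u) \<omega> * (S T \<omega>)\<^sup>2)" by simp
  qed
  also have "\<dots> \<le> (\<integral>\<omega>. (S T \<omega>)\<^sup>2 \<partial>M)"
  proof (rule integral_mono[OF _ I2])
    show "integrable M (\<lambda>\<omega>. \<Sum>u\<in>P. indicator (A u) \<omega> * (S T \<omega>)\<^sup>2)"
    proof (rule Bochner_Integration.integrable_sum)
      fix u assume "u \<in> P"
      from integrable_mult_indicator[OF AM[OF this] I2]
      show "integrable M (\<lambda>\<omega>. indicator (A u) \<omega> * (S T \<omega>)\<^sup>2)" by simp
    qed
    fix \<omega>
    have "(\<Sum>u\<in>P. indicator (A u) \<omega> :: real) = indicator (\<Union>u\<in>P. A u) \<omega>"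
      by (rule indicator_UN_disjoint[symmetric, OF P(1) disj])
    then show "(\<Sum>u\<in>P. indicator (A u) \<omega> * (S T \<omega>)\<^sup>2) \<le> (S T \<omega>)\<^sup>2"
      unfolding sum_distrib_right[symmetric] by (simp add: indicator_def)
  qed
  finally have "ennreal (l\<^sup>2 * prob {\<omega> \<in> space M. \<exists>u\<in>P. l \<le> \<bar>S u \<omega>\<bar>}) \<le> ennreal (\<integral>\<omega>. (S T \<omega>)\<^sup>2 \<partial>M)"
    by (rule ennreal_leI)
  also have "\<dots> = mean_sq M (S T)"
    unfolding mean_sq_def by (rule nn_integral_eq_integral[symmetric, OF I2]) simp
  finally show ?thesis .
qed

text \<open>Let \<open>v s\<close> be the integral of \<sigma>^2 up to s. The probability that |I u
  - I s| reaches l at some rational u in [s, 1) is at most 4 (L - v s) / l^2, which vanishes as s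
  tends to 1. Second moments alone would give an L^2 limit; the maximal inequality makes the control
  uniform along the path.\<close>

lemma ito_integral_convergent:
  assumes I: "ito_integral M F B (\<lambda>t \<omega>. \<sigma> t) I" and \<sigma>: "continuous_on {0..<1} \<sigma>"
    and L: "((\<lambda>t. integral {0..t} (\<lambda>r. (\<sigma> r)\<^sup>2)) \<longlongrightarrow> L) (at_left 1)"
  shows "AE \<omega> in M. \<exists>c. ((\<lambda>t. I t \<omega>) \<longlongrightarrow> c) (at_left 1)"
proof -
  define v where "v = (\<lambda>t. integral {0..t} (\<lambda>r. (\<sigma> r)\<^sup>2))"
  define g where "g = (\<lambda>r. indicator {0..<1} r * \<sigma> r)"
  have g: "g \<in> borel_measurable borel" "\<forall>r\<in>{0..<1}. g r = \<sigma> r"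
    using borel_measurable_continuous_on_indicator[OF _ \<sigma>] by (auto simp: g_def)
  have \<sigma>2: "continuous_on {a..b} (\<lambda>r. (\<sigma> r)\<^sup>2)" if "0 \<le> a" "b < 1" for a b
    using that by (intro continuous_intros continuous_on_subset[OF \<sigma>]) auto
  have v_diff: "integral {s..t} (\<lambda>r. (\<sigma> r)\<^sup>2) = v t - v s" if "0 \<le> s" "s \<le> t" "t < 1" for s t
    using Henstock_Kurzweil_Integration.integral_combine[OF that(1,2) integrable_continuous_real[OF \<sigma>2[OF order_refl that(3)]]]
    by (simp add: v_def)
  have v_mono: "v s \<le> v t" if "0 \<le> s" "s \<le> t" "t < 1" for s t
  proof -
    have "0 \<le> integral {s..t} (\<lambda>r. (\<sigma> r)\<^sup>2)" by (rule Henstock_Kurzweil_Integration.integral_nonneg[OF integrable_continuous_real[OF \<sigma>2]]) (use that in auto)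
    then show ?thesis using v_diff[OF that] by simp
  qed
  have v_le: "v s \<le> L" if "0 \<le> s" "s < 1" for s
  proof (rule tendsto_lowerbound[OF L[folded v_def]])
    show "\<forall>\<^sub>F t in at_left 1. v s \<le> v t"
      by (rule eventually_at_leftI[OF _ that(2)]) (use that v_mono in auto)
  qed simp
  \<comment> \<open>Replacing \<open>v t\<close> by its limit L frees the bound from t, so that it
    serves all finite sets of later times at once.\<close>
  have incr: "mean_sq M (\<lambda>\<omega>. I t \<omega> - I s \<omega>) \<le> ennreal (4 * (L - v s))" if st: "0 \<le> s" "s \<le> t" "t < 1" for s t
  proof -
    have "mean_sq M (\<lambda>\<omega>. I t \<omega> - I s \<omega>) \<le> 4 * mean_sq lborel (\<lambda>r. indicator {s<..t} r * g r)"
      by (rule ito_increment_mean_sq(1)[OF I g st])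
    also have "\<dots> \<le> 4 * mean_sq lborel (\<lambda>r. indicator {s..t} r * \<sigma> r)"
      using st g(2) by (intro mult_left_mono mean_sq_mono) (auto simp: indicator_def)
    also have "\<dots> = 4 * ennreal (v t - v s)"
      using st by (subst mean_sq_interval) (auto simp: v_diff intro!: continuous_on_subset[OF \<sigma>])
    also have "\<dots> \<le> 4 * ennreal (L - v s)"
      using st v_le[of t] by (intro mult_left_mono ennreal_leI) auto
    also have "\<dots> = ennreal (4 * (L - v s))"
      using st v_le[of s] by (subst ennreal_mult) auto
    finally show ?thesis .
  qed
  have IF: "I t \<in> borel_measurable (F t)" "I t \<in> borel_measurable M" if "t \<in> {0..<1}" for t
    using ito_integral_measurable[OF I that] .
  have finite_bound: "l\<^sup>2 * prob {\<omega> \<in> space M. \<exists>u\<in>P. l \<le> \<bar>I u \<omega> - I s \<omega>\<bar>} \<le> 4 * (L - v s)"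
    if s: "0 \<le> s" "s < 1" and P: "finite P" "P \<subseteq> {s..<1}" and l: "0 < l" for s P l
  proof -
    \<comment> \<open>The last time of P closes the maximal inequality; inserting s covers an empty
      P.\<close>
    define T where "T = Max (insert s P)"
    have "T \<in> insert s P" unfolding T_def using P by (intro Max_in) auto
    then have T: "s \<le> T" "T < 1" "T \<in> {0..<1}" using P s by auto
    have uT: "u \<le> T" if "u \<in> P" for u unfolding T_def using P that by (intro Max_ge) auto
    have u: "s \<le> u" "0 \<le> u" "u < 1" "u \<le> 1" "u \<in> {0..<1}" if "u \<in> P" for u using that P s by auto
    have "ennreal (l\<^sup>2 * prob {\<omega> \<in> space M. \<exists>u\<in>P. l \<le> \<bar>I u \<omega> - I s \<omega>\<bar>}) \<le> mean_sq M (\<lambda>\<omega>. I T \<omega> - I s \<omega>)"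
    proof (rule maximal_inequality[where S = "\<lambda>u \<omega>. I u \<omega> - I s \<omega>", OF P(1) _ l])
      show "P \<subseteq> {0..1}" using P(2) s by auto
      show "(\<lambda>\<omega>. I T \<omega> - I s \<omega>) \<in> borel_measurable M" using T s IF by (intro borel_measurable_diff) auto
      show "mean_sq M (\<lambda>\<omega>. I T \<omega> - I s \<omega>) < \<infinity>" using incr[OF s(1) T(1,2)] by (rule le_less_trans) simp
      fix x assume x: "x \<in> P"
      show "(\<lambda>\<omega>. I x \<omega> - I s \<omega>) \<in> borel_measurable (F x)"
        using u[OF x] s measurable_F_mono[OF s(1) u(1)[OF x] u(4)[OF x] IF(1)]
        by (intro borel_measurable_diff IF(1)) auto
      show "mean_sq M (\<lambda>\<omega>. I x \<omega> - I s \<omega>) < \<infinity>" using incr[OF s(1) u(1)[OF x] u(3)[OF x]] by (rule le_less_trans) simp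
      fix Y assume "Y \<in> borel_measurable (F x)" "mean_sq M Y < \<infinity>"
      from ito_increment_mean_sq(2)[OF I g u(2)[OF x] uT[OF x] T(2) this]
      show "(\<integral>\<omega>. Y \<omega> * ((I T \<omega> - I s \<omega>) - (I x \<omega> - I s \<omega>)) \<partial>M) = 0" by simp
    qed
    also have "\<dots> \<le> ennreal (4 * (L - v s))" by (rule incr[OF s(1) T(1,2)])
    finally show ?thesis using v_le[OF s] by (subst (asm) ennreal_le_iff) auto
  qed
  \<comment> \<open>Rational times keep this a countable union of events, hence measurable.\<close>
  define E where "E = (\<lambda>l s. {\<omega> \<in> space M. \<exists>u\<in>\<rat> \<inter> {s..<1}. l \<le> \<bar>I u \<omega> - I s \<omega>\<bar>})"
  have EM: "E l s \<in> sets M" if "0 \<le> s" "s < 1" for l s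
  proof -
    have [measurable]: "I u \<in> borel_measurable M" if "u \<in> \<rat> \<inter> {s..<1}" for u
      using that \<open>0 \<le> s\<close> by (intro IF(2)) auto
    have [measurable]: "I s \<in> borel_measurable M" using that by (intro IF(2)) auto
    have "E l s = (\<Union>u\<in>\<rat> \<inter> {s..<1}. {\<omega> \<in> space M. l \<le> \<bar>I u \<omega> - I s \<omega>\<bar>})" by (auto simp: E_def)
    also have "\<dots> \<in> sets M"
      by (intro sets.countable_UN'' countable_Int1 countable_rat) measurable
    finally show ?thesis .
  qed
  have E_bound: "l\<^sup>2 * prob (E l s) \<le> 4 * (L - v s)" if s: "0 \<le> s" "s < 1" and l: "0 < l" for s l
  proof -
    define D where "D = \<rat> \<inter> {s..<1}"
    obtain q where q: "q \<in> \<rat>" "s < q" "q < 1" using Rats_dense_in_real[OF s(2)] by blast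
    have D: "countable D" "D \<noteq> {}" using q by (auto simp: D_def countable_Int1 countable_rat)
    \<comment> \<open>Along an enumeration of the rational times, \<open>E l s\<close> is the
      increasing union of events over finite sets of times, each within the same bound
      \<open>finite_bound\<close>.\<close>
    define A where "A = (\<lambda>n. {\<omega> \<in> space M. \<exists>u\<in>from_nat_into D ` {..n}. l \<le> \<bar>I u \<omega> - I s \<omega>\<bar>})"
    have sub: "from_nat_into D ` {..n} \<subseteq> {s..<1}" for n
      using from_nat_into[OF D(2)] by (auto simp: D_def)
    have AM: "A n \<in> sets M" for n
    proof -
      have [measurable]: "I u \<in> borel_measurable M" if "u \<in> insert s (from_nat_into D ` {..n})" for u
        using that s sub[of n] by (intro IF(2)) auto
      show ?thesis unfolding A_def by measurable
    qed
    have "(\<Union>n. A n) = E l s"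
      using from_nat_into_surj[OF D(1)] from_nat_into[OF D(2)] by (fastforce simp: A_def E_def D_def[symmetric])
    moreover have "(\<lambda>n. prob (A n)) \<longlonglongrightarrow> prob (\<Union>n. A n)"
    proof (rule finite_Lim_measure_incseq)
      show "range A \<subseteq> sets M" using AM by auto
      have "A m \<subseteq> A n" if "m \<le> n" for m n
        using that unfolding A_def by (blast intro: order_trans)
      then show "incseq A" by (simp add: incseq_def)
    qed
    ultimately have "(\<lambda>n. l\<^sup>2 * prob (A n)) \<longlonglongrightarrow> l\<^sup>2 * prob (E l s)" by (intro tendsto_intros) simp
    then show ?thesis
    proof (rule LIMSEQ_le_const2, intro exI allI impI)
      fix n
      show "l\<^sup>2 * prob (A n) \<le> 4 * (L - v s)"
        unfolding A_def by (rule finite_bound[OF s _ sub l]) simp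
    qed
  qed
  have AE_osc: "AE \<omega> in M. \<exists>m::nat. \<omega> \<notin> E l (1 - inverse (real (Suc m)))" if l: "0 < l" for l
  proof -
    define s where "s = (\<lambda>m::nat. 1 - inverse (real (Suc m)))"
    have s: "0 \<le> s m" "s m < 1" for m by (auto simp: s_def inverse_le_1_iff)
    \<comment> \<open>The base point moves with m, so the events \<open>E l (s m)\<close> need not
      decrease; bounding \<open>N\<close> by each of them separately makes monotonicity
      irrelevant.\<close>
    define N where "N = (\<Inter>m. E l (s m))"
    have NM: "N \<in> sets M" unfolding N_def using EM[OF s] by auto
    have "filterlim s (at_left 1) sequentially"
      using LIMSEQ_inverse_real_of_nat_add_minus[of 1] s(2) by (simp add: filterlim_at s_def)
    from filterlim_compose[OF L[folded v_def] this] have "(\<lambda>m. v (s m)) \<longlonglongrightarrow> L" .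
    then have "(\<lambda>m. 4 * (L - v (s m))) \<longlonglongrightarrow> 4 * (L - L)" by (intro tendsto_intros)
    moreover have "l\<^sup>2 * prob N \<le> 4 * (L - v (s m))" for m
    proof -
      have "prob N \<le> prob (E l (s m))" using EM[OF s] by (intro finite_measure_mono) (auto simp: N_def)
      then have "l\<^sup>2 * prob N \<le> l\<^sup>2 * prob (E l (s m))" by (intro mult_left_mono) auto
      also have "\<dots> \<le> 4 * (L - v (s m))" by (rule E_bound[OF s l])
      finally show ?thesis .
    qed
    ultimately have "l\<^sup>2 * prob N \<le> 4 * (L - L)" by (intro LIMSEQ_le_const) auto
    then have "prob N = 0" using l by (simp add: mult_le_0_iff measure_le_0_iff)
    then have "N \<in> null_sets M" using NM by (simp add: null_sets_def emeasure_eq_measure)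
    then have "AE \<omega> in M. \<omega> \<notin> N" by (rule AE_not_in)
    then show ?thesis by (simp add: N_def s_def)
  qed
  have "AE \<omega> in M. \<forall>j::nat. \<exists>m::nat. \<omega> \<notin> E (inverse (real (Suc j))) (1 - inverse (real (Suc m)))"
    unfolding AE_all_countable using AE_osc by auto
  moreover have "AE \<omega> in M. continuous_on {0..<1} (\<lambda>t. I t \<omega>)" using I by (simp add: ito_integral_def)
  moreover have "AE \<omega> in M. \<omega> \<in> space M" by simp
  ultimately show ?thesis
  proof eventually_elim
    case (elim \<omega>)
    show ?case
    proof (rule at_left_convergent_of_cauchy)
      fix e :: real assume "0 < e"
      then obtain j :: nat where j: "inverse (real (Suc j)) < e"
        using reals_Archimedean by blast
      obtain m :: nat where m: "\<omega> \<notin> E (inverse (real (Suc j))) (1 - inverse (real (Suc m)))" using elim(1) by blast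
      define s where "s = 1 - inverse (real (Suc m))"
      have s: "0 \<le> s" "s < 1" by (auto simp: s_def inverse_le_1_iff)
      have rat: "\<bar>I u \<omega> - I s \<omega>\<bar> < e" if "u \<in> \<rat>" "s \<le> u" "u < 1" for u
        using m elim(3) that j unfolding E_def s_def[symmetric] by force
      have "\<bar>I t \<omega> - I s \<omega>\<bar> \<le> e" if t: "s \<le> t" "t < 1" for t
      proof (rule field_le_epsilon)
        fix d :: real assume "0 < d"
        then obtain r where r: "0 < r" "\<And>u. u \<in> {0..<1} \<Longrightarrow> dist u t < r \<Longrightarrow> dist (I u \<omega>) (I t \<omega>) < d"
          using elim(2) t s unfolding continuous_on_iff by (metis atLeastLessThan_iff order_trans)
        \<comment> \<open>The rational q is chosen to the right of t, since one to the left could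
          fall below s, where \<open>rat\<close> says nothing.\<close>
        have "t < min 1 (t + r)" using t r by simp
        from Rats_dense_in_real[OF this] obtain q where q: "q \<in> \<rat>" "t < q" "q < min 1 (t + r)" by blast
        then have "\<bar>I q \<omega> - I t \<omega>\<bar> < d" using r(2)[of q] t s by (auto simp: dist_real_def)
        with rat[of q] q t show "\<bar>I t \<omega> - I s \<omega>\<bar> \<le> e + d" by simp
      qed
      with s(2) show "\<exists>s<1. \<forall>t\<in>{s..<1}. \<bar>I t \<omega> - I s \<omega>\<bar> \<le> e" by auto
    qed
  qed
qed

text \<open>Convergence along a continuum of times is not evidently an event. Completeness of
  \<open>M\<close> makes the exceptional set measurable, so that the probability in
  \<open>pinned_diffusions\<close> is meaningful and equal to 1.\<close>

lemma AE_prob_eq_1: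
  assumes "AE \<omega> in M. Q \<omega>"
  shows "prob {\<omega> \<in> space M. Q \<omega>} = 1"
proof -
  have "{\<omega> \<in> space M. \<not> Q \<omega>} \<in> null_sets M" using assms AE_iff_null_sets by simp
  then have "space M - {\<omega> \<in> space M. \<not> Q \<omega>} \<in> sets M" by auto
  also have "space M - {\<omega> \<in> space M. \<not> Q \<omega>} = {\<omega> \<in> space M. Q \<omega>}" by auto
  finally show ?thesis using assms prob_Collect_eq_1 by blast
qed

end

section \<open>Pinning of the diffusions, path by path\<close>

theorem proposition2p2:
  fixes M :: "'a measure" and F :: "real \<Rightarrow> 'a measure" and B :: "real \<Rightarrow> 'a \<Rightarrow> real"
    and h \<sigma> :: "real \<Rightarrow> real" and X :: "real \<Rightarrow> real \<Rightarrow> real \<Rightarrow> 'a \<Rightarrow> real"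
  assumes "brownian_motion M F B"
    and "continuous_on {0..<1} h"
    and "continuous_on {0..<1} \<sigma>" and "\<And>t. t \<in> {0..<1} \<Longrightarrow> 0 < \<sigma> t"
    and "\<And>x y. strong_solution M F B (\<lambda>t z. h t * (y - z)) (\<lambda>t z. \<sigma> t) x (X x y)"
    and A1: "bdd_below (h ` {0..<1})" "filterlim (\<lambda>t. integral {0..t} h) at_top (at_left 1)"
    and A2: "\<exists>L. ((\<lambda>t. integral {0..t} (\<lambda>r. (\<sigma> r)\<^sup>2)) \<longlongrightarrow> L) (at_left 1)"
  shows "pinned_diffusions M X"
proof -
  interpret brownian_motion M F B by fact
  obtain L where L: "((\<lambda>t. integral {0..t} (\<lambda>r. (\<sigma> r)\<^sup>2)) \<longlongrightarrow> L) (at_left 1)" using A2 by blast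
  show ?thesis
    unfolding pinned_diffusions_def
  proof (intro allI)
    fix x y
    obtain I where I: "ito_integral M F B (\<lambda>t \<omega>. \<sigma> t) I"
      and eq: "AE \<omega> in M. \<forall>t\<in>{0..<1}.
           (\<lambda>r. h r * (y - X x y r \<omega>)) absolutely_integrable_on {0..t} \<and>
           X x y t \<omega> = x + integral {0..t} (\<lambda>r. h r * (y - X x y r \<omega>)) + I t \<omega>"
      and cont: "AE \<omega> in M. continuous_on {0..<1} (\<lambda>t. X x y t \<omega>)"
      using assms(5)[of y x] unfolding strong_solution_def by blast
    from ito_integral_convergent[OF I assms(3) L] eq cont
    have "AE \<omega> in M. ((\<lambda>t. X x y t \<omega>) \<longlongrightarrow> y) (at_left 1)"
    proof eventually_elim
      case (elim \<omega>)
      then obtain c where "((\<lambda>t. I t \<omega>) \<longlongrightarrow> c) (at_left 1)" by blast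
      with elim show ?case
        by (intro linear_equation_pinned[OF assms(2) _ _ _ A1, of _ x y "\<lambda>t. I t \<omega>" c]) auto
    qed
    then show "measure M {\<omega> \<in> space M. ((\<lambda>t. X x y t \<omega>) \<longlongrightarrow> y) (at_left 1)} = 1"
      by (rule AE_prob_eq_1)
  qed
qed

end
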